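(* Let $n\ge2$, let $f\in\Phi_n$ be non-constant, and let $X=\{x_k\}_1^\infty$ be a sequence of points $x_k\in\mathbb{R}^n$ of the form $x_k=(0,x_{k2},\dots,x_{kn})$. If the real sequence $X_n:=\{x_{kn}\}_{k=1}^\infty$ of $n$-th coordinates satisfies $d_*(X_n)>0$ and $D^*(X_n)=0$, then $f$ is strongly $X$-positive definite, i.e. there exists $c>0$ such that $$\sum_{k,j=1}^m\xi_k\overline{\xi_j}f(|x_k-x_j|)\ge c\sum_{k=1}^m|\xi_k|^2$$ for all $m\in\mathbb{N}$ and $\xi_1,\dots,\xi_m\in\mathbb{C}$.
   Context: $\Phi_n$ is the class of radial positive definite functions: bounded continuous functions $f$ on $[0,+\infty)$ such that $x\mapsto f(|x|)$ is positive definite on $\mathbb{R}^n$ (i.e. $\sum_{k,j=1}^m\xi_k\overline{\xi_j}f(|y_k-y_j|)\ge0$ for all finite sets of points $y_k\in\mathbb{R}^n$ and $\xi_k\in\mathbb{C}$). For a real sequence $\Lambda=\{\lambda_k\}$: $d_*(\Lambda)=\inf_{k\ne j}|\lambda_k-\lambda_j|$; with $n(r)$ the largest number of points $\lambda_k$ contained in an interval of length $r$, the upper density is $D^*(\Lambda)=\lim_{r\to+\infty}n(r)/r$. *)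

theory Defs
  imports "HOL-Analysis.Analysis" "HOL-Library.Complex_Order"
begin

text \<open>
  The order on \<^typ>\<open>complex\<close> is that of \<open>HOL-Library.Complex_Order\<close>: \<open>w \<le> z\<close> means that
  \<open>z - w\<close> is real and nonnegative.
\<close>

definition positive_definite :: "('a::real_normed_vector \<Rightarrow> complex) \<Rightarrow> bool" where
  "positive_definite g \<longleftrightarrow>
     (\<forall>m (y :: nat \<Rightarrow> 'a) (\<xi> :: nat \<Rightarrow> complex).
        0 \<le> (\<Sum>k<m. \<Sum>j<m. \<xi> k * cnj (\<xi> j) * g (y k - y j)))"

text \<open>
  \<open>Phi TYPE(real ^ 'n)\<close> is the class \<open>\<Phi>\<^sub>n\<close> with \<open>n = CARD('n)\<close>. Only the values of \<open>f\<close> on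
  \<open>[0, \<infinity>)\<close> matter.
\<close>

definition Phi :: "'a::euclidean_space itself \<Rightarrow> (real \<Rightarrow> complex) set" where
  "Phi _ = {f. continuous_on {0..} f \<and> bounded (f ` {0..}) \<and>
               positive_definite (\<lambda>x::'a. f (norm x))}"

definition strongly_positive_definite ::
    "(nat \<Rightarrow> 'a::real_normed_vector) \<Rightarrow> (real \<Rightarrow> complex) \<Rightarrow> bool" where
  "strongly_positive_definite x f \<longleftrightarrow>
     (\<exists>c::real. c > 0 \<and>
       (\<forall>m (\<xi> :: nat \<Rightarrow> complex).
          (\<Sum>k<m. \<Sum>j<m. \<xi> k * cnj (\<xi> j) * f (norm (x k - x j)))
            \<ge> complex_of_real (c * (\<Sum>k<m. (cmod (\<xi> k))\<^sup>2))))"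

definition separation :: "(nat \<Rightarrow> real) \<Rightarrow> real" where
  "separation l = (INF (k, j)\<in>{(k, j). k \<noteq> j}. \<bar>l k - l j\<bar>)"

text \<open>
  The number \<open>n(r)\<close> is counted with values in \<open>[0, \<infinity>]\<close>, so that it is \<open>\<infinity>\<close> (and not \<open>0\<close>,
  as with \<^const>\<open>card\<close>) if intervals of length \<open>r\<close> contain arbitrarily many terms of the
  sequence. Terms are counted with multiplicity.
\<close>

definition interval_count :: "(nat \<Rightarrow> real) \<Rightarrow> real \<Rightarrow> ennreal" where
  "interval_count l r = (SUP a. emeasure (count_space UNIV) {k. l k \<in> {a..a + r}})"

definition upper_density :: "(nat \<Rightarrow> real) \<Rightarrow> ennreal" where
  "upper_density l = Lim at_top (\<lambda>r. interval_count l r / ennreal r)"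

text \<open>The limit always exists, by subadditivity of \<^const>\<open>interval_count\<close>.\<close>

lemma interval_count_mono:
  assumes "r \<le> s" shows "interval_count l r \<le> interval_count l s"
  unfolding interval_count_def using assms by (intro SUP_mono' emeasure_mono) auto

lemma interval_count_add:
  assumes "0 \<le> r" "0 \<le> s"
  shows "interval_count l (r + s) \<le> interval_count l r + interval_count l s"
proof -
  let ?M = "count_space (UNIV :: nat set)"
  have "emeasure ?M {k. l k \<in> {a..a + (r + s)}} \<le> interval_count l r + interval_count l s" for a
  proof -
    have "{k. l k \<in> {a..a + (r + s)}} \<subseteq> {k. l k \<in> {a..a + r}} \<union> {k. l k \<in> {a + r..(a + r) + s}}"
      by auto
    then have "emeasure ?M {k. l k \<in> {a..a + (r + s)}}
        \<le> emeasure ?M ({k. l k \<in> {a..a + r}} \<union> {k. l k \<in> {a + r..(a + r) + s}})"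
      by (intro emeasure_mono) auto
    also have "\<dots> \<le> emeasure ?M {k. l k \<in> {a..a + r}} + emeasure ?M {k. l k \<in> {a + r..(a + r) + s}}"
      by (intro emeasure_subadditive) auto
    also have "\<dots> \<le> interval_count l r + interval_count l s"
      unfolding interval_count_def by (intro add_mono SUP_upper) auto
    finally show ?thesis .
  qed
  then show ?thesis
    unfolding interval_count_def[of l "r + s"] by (intro SUP_least)
qed

lemma interval_count_mult:
  assumes "0 \<le> s" shows "interval_count l (real (Suc p) * s) \<le> of_nat (Suc p) * interval_count l s"
proof (induction p)
  case 0
  then show ?case by simp
next
  case (Suc p)
  have "interval_count l (real (Suc (Suc p)) * s) = interval_count l (real (Suc p) * s + s)"
    by (simp add: algebra_simps)
  also have "\<dots> \<le> interval_count l (real (Suc p) * s) + interval_count l s"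
    using assms by (intro interval_count_add) auto
  also have "\<dots> \<le> of_nat (Suc p) * interval_count l s + interval_count l s"
    by (intro add_mono Suc order_refl)
  finally show ?case by (simp add: algebra_simps)
qed

lemma upper_density_tendsto:
  "((\<lambda>r. interval_count l r / ennreal r) \<longlongrightarrow> upper_density l) at_top"
proof -
  let ?L = "INF s\<in>{0<..}. interval_count l s / ennreal s"
  have "((\<lambda>r. interval_count l r / ennreal r) \<longlongrightarrow> ?L) at_top"
  proof (rule order_tendstoI)
    fix a assume a: "a < ?L"
    show "\<forall>\<^sub>F r in at_top. a < interval_count l r / ennreal r"
      using eventually_gt_at_top[of 0]
    proof eventually_elim
      case (elim r)
      then have "?L \<le> interval_count l r / ennreal r" by (intro INF_lower) auto
      with a show ?case by (rule less_le_trans)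
    qed
  next
    fix a assume "?L < a"
    then obtain s where s: "s > 0" "interval_count l s / ennreal s < a"
      by (auto simp: INF_less_iff)
    have "interval_count l s < top"
    proof (rule ccontr)
      assume "\<not> interval_count l s < top"
      then have "interval_count l s = top" using top.not_eq_extremum by blast
      then have "interval_count l s / ennreal s = top" by (simp add: ennreal_top_divide)
      with s show False by simp
    qed
    then obtain c where c: "interval_count l s = ennreal c" "c \<ge> 0"
      by (cases "interval_count l s") auto
    have le: "\<forall>\<^sub>F r in at_top. interval_count l r / ennreal r \<le> ennreal ((1 / s + 1 / r) * c)"
      using eventually_gt_at_top[of 0]
    proof eventually_elim
      case (elim r)
      define p where "p = nat \<lfloor>r / s\<rfloor>"
      have p: "real p \<le> r / s" "r / s \<le> real (Suc p)"
        using elim s unfolding p_def by (auto simp: of_nat_nat) linarith+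
      have "interval_count l r \<le> interval_count l (real (Suc p) * s)"
        using p s by (intro interval_count_mono) (simp add: field_simps)
      also have "\<dots> \<le> of_nat (Suc p) * interval_count l s"
        using s by (intro interval_count_mult) auto
      also have "\<dots> = ennreal (real (Suc p) * c)"
        using c by (simp only: ennreal_of_nat_eq_real_of_nat) (simp add: ennreal_mult)
      finally have "interval_count l r / ennreal r \<le> ennreal (real (Suc p) * c) / ennreal r"
        by (rule divide_right_mono_ennreal)
      also have "\<dots> = ennreal (real (Suc p) * c / r)"
        using elim c by (intro divide_ennreal) auto
      also have "\<dots> \<le> ennreal ((1 / s + 1 / r) * c)"
      proof (rule ennreal_leI)
        have "real (Suc p) / r \<le> 1 / s + 1 / r"
          using p elim s by (simp add: field_simps)
        from mult_right_mono[OF this c(2)] show "real (Suc p) * c / r \<le> (1 / s + 1 / r) * c"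
          by simp
      qed
      finally show ?case .
    qed
    have "((\<lambda>r. (1 / s + 1 / r) * c) \<longlongrightarrow> (1 / s + 0) * c) at_top"
      by (intro tendsto_intros tendsto_divide_0[OF tendsto_const] filterlim_at_top_imp_at_infinity
          filterlim_ident)
    then have "((\<lambda>r. ennreal ((1 / s + 1 / r) * c)) \<longlongrightarrow> ennreal ((1 / s + 0) * c)) at_top"
      by (rule tendsto_ennrealI)
    moreover have "ennreal ((1 / s + 0) * c) < a"
      using s c by (simp add: divide_ennreal)
    ultimately have "\<forall>\<^sub>F r in at_top. ennreal ((1 / s + 1 / r) * c) < a"
      by (rule order_tendstoD(2))
    with le show "\<forall>\<^sub>F r in at_top. interval_count l r / ennreal r < a"
      by eventually_elim (rule le_less_trans)
  qed
  then show ?thesis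
    unfolding upper_density_def by (simp add: tendsto_Lim)
qed

end

theory Submission
  imports Defs "HOL-Probability.Probability" "HOL-Real_Asymp.Real_Asymp"
begin

text \<open>
  Let \<open>a\<close> and \<open>b\<close> be the first and the last unit vector. Since \<open>f(|\<cdot>|)\<close> is radial and the points are
  orthogonal to \<open>a\<close>, its quadratic form does not change if the points are rotated in the plane of
  \<open>a\<close> and \<open>b\<close>. Represent \<open>f(|\<cdot>|)\<close> by positive measures (Bochner) and average over the angle:
  a frequency \<open>u\<close> whose projection to the plane has length \<open>\<rho>\<close> then contributes at least a multiple
  of the mean of \<open>|\<Sum>\<^sub>k c\<^sub>k exp(i x\<^sub>k\<^sub>n t)|\<^sup>2\<close> over \<open>[-\<rho>, \<rho>]\<close>, where \<open>|c\<^sub>k| = |\<xi>\<^sub>k|\<close>. As the sequence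
  \<open>X\<^sub>n\<close> is separated and has upper density zero, this mean is bounded below by a multiple of
  \<open>\<Sum>\<^sub>k |\<xi>\<^sub>k|\<^sup>2\<close>, uniformly for \<open>\<rho>\<close> away from \<open>0\<close>. The frequencies with small \<open>\<rho>\<close> do not carry all the
  mass because \<open>f\<close> is not constant.

  For the bound on exponential sums, recover \<open>c\<^sub>k\<close> by integrating against the kernel whose Fourier
  transform is that of \<open>cos\<^sup>2\<^sup>P\<close> times an even polynomial vanishing at \<open>x\<^sub>j\<^sub>n - x\<^sub>k\<^sub>n\<close> for all neighbours
  within distance \<open>4P\<close>. The contributions of the remaining frequencies decay so fast that they are
  absorbed by a Schur test, provided there are few neighbours compared to \<open>P\<close>.
\<close>

subsection \<open>Fourier transforms of powers of the cosine\<close>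

definition cos_ft :: "nat \<Rightarrow> real \<Rightarrow> complex" where
  "cos_ft q z = integral {-(pi/2)..pi/2} (\<lambda>t. complex_of_real (cos t ^ (2 * q)) * cis (z * t))"

lemma cis_times_has_vector_derivative:
  "((\<lambda>t. cis (z * t)) has_vector_derivative (\<i> * of_real z * cis (z * t))) (at t within A)"
proof -
  have "((\<lambda>w. exp (\<i> * of_real z * w)) has_field_derivative (\<i> * of_real z * exp (\<i> * of_real z *
      of_real t)))
      (at (of_real t) within UNIV)"
    by (auto intro!: derivative_eq_intros)
  then have "((\<lambda>t. exp (\<i> * of_real z * of_real t))
      has_vector_derivative (\<i> * of_real z * exp (\<i> * of_real z * of_real t))) (at t within A)"
    by (rule has_vector_derivative_real_field)
  then show ?thesis by (simp add: cis_conv_exp mult.assoc)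
qed

lemma cos_power_Suc_has_real_derivative:
  "((\<lambda>t. cos t ^ Suc m) has_real_derivative (- real (Suc m) * cos t ^ m * sin t)) (at t within A)"
  by (auto intro!: derivative_eq_intros simp: algebra_simps simp del: power_Suc)

lemma cos_ft_Suc:
  "complex_of_real ((real (2 * Suc q))\<^sup>2 - z\<^sup>2) * cos_ft (Suc q) z
     = complex_of_real (real (2 * Suc q) * (real (2 * Suc q) - 1)) * cos_ft q z"
proof -
  define n where "n = 2 * Suc q"
  have n: "n = Suc (Suc (2 * q))" "n - 1 = Suc (2 * q)" "n - 2 = 2 * q" by (auto simp: n_def)
  define H where "H = (\<lambda>t::real. (complex_of_real (- real n * cos t ^ (n - 1) * sin t)
      - \<i> * of_real z * of_real (cos t ^ n)) * cis (z * t))"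
  let ?e = "\<lambda>q t. complex_of_real (cos t ^ (2 * q)) * cis (z * t)"
  let ?h = "\<lambda>t. complex_of_real (real n * (real n - 1)) * ?e q t - complex_of_real ((real n)\<^sup>2 -
      z\<^sup>2) * (of_real (cos t ^ n) * cis (z * t))"
  have "(H has_vector_derivative ?h t) (at t within {-(pi/2)..pi/2})" for t
  proof -
    have d1: "((\<lambda>t. complex_of_real (- real n * cos t ^ (n - 1) * sin t)) has_vector_derivative
       of_real (real n * (real n - 1) * cos t ^ (2 * q) - (real n)\<^sup>2 *
           cos t ^ n)) (at t within {-(pi/2)..pi/2})"
    proof (rule has_vector_derivative_of_real)
      have "((\<lambda>t. - real n * cos t ^ (n - 1) * sin t) has_real_derivative
        (real n * (real (n - 1) * cos t ^ (n - 2) * (sin t * sin t)) - real n * cos t ^ (n - 1) *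
            cos t)) (at t within {-(pi/2)..pi/2})"
        unfolding n using cos_power_Suc_has_real_derivative[of "2 * q" t]
        by (auto intro!: derivative_eq_intros simp: algebra_simps simp del: power_Suc)
      moreover have "real n * (real (n - 1) * cos t ^ (n - 2) * (sin t * sin t)) - real n *
          cos t ^ (n - 1) * cos t
        = real n * (real n - 1) * cos t ^ (2 * q) - (real n)\<^sup>2 * cos t ^ n"
      proof -
        have s: "sin t * sin t = 1 - cos t * cos t"
          using sin_cos_squared_add[of t] by (simp add: power2_eq_square)
        show ?thesis unfolding n s by (simp add: algebra_simps power2_eq_square)
      qed
      ultimately show "((\<lambda>t. - real n * cos t ^ (n - 1) * sin t) has_real_derivative
        real n * (real n - 1) * cos t ^ (2 * q) - (real n)\<^sup>2 *
            cos t ^ n) (at t within {-(pi/2)..pi/2})"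
        by simp
    qed
    have d2: "((\<lambda>t. complex_of_real (cos t ^ n))
        has_vector_derivative of_real (- real n * cos t ^ (n - 1) *
        sin t)) (at t within {-(pi/2)..pi/2})"
      using cos_power_Suc_has_real_derivative[of "Suc (2 * q)" t]
      by (intro has_vector_derivative_of_real)
         (simp add: n del: power_Suc)
    show ?thesis unfolding H_def
      apply (rule has_vector_derivative_eq_rhs)
       apply (rule has_vector_derivative_mult[OF has_vector_derivative_diff[OF d1
           has_vector_derivative_mult_right[OF d2]] cis_times_has_vector_derivative])
      apply (simp add: algebra_simps power2_eq_square)
      done
  qed
  then have "(?h has_integral (H (pi/2) - H (-(pi/2)))) {-(pi/2)..pi/2}"
    by (intro fundamental_theorem_of_calculus) auto
  moreover have "H (pi/2) - H (-(pi/2)) = 0"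
    by (simp add: H_def n)
  ultimately have *: "integral {-(pi/2)..pi/2} ?h = 0" by (simp add: integral_unique)
  have i: "?e q integrable_on {-(pi/2)..pi/2}" for q
    by (intro integrable_continuous_interval continuous_intros)
  have "integral {-(pi/2)..pi/2} ?h
      = integral {-(pi/2)..pi/2} (\<lambda>t. complex_of_real (real n * (real n - 1)) * ?e q t)
        - integral {-(pi/2)..pi/2} (\<lambda>t. complex_of_real ((real n)\<^sup>2 - z\<^sup>2) * ?e (Suc q) t)"
    unfolding n_def by (intro integral_diff integrable_on_mult_right i)
  also have "\<dots> = complex_of_real (real n * (real n - 1)) * cos_ft q z -
      complex_of_real ((real n)\<^sup>2 - z\<^sup>2) * cos_ft (Suc q) z"
    unfolding cos_ft_def by (simp only: integral_mult_right)
  finally show ?thesis using * by (simp only: n_def right_minus_eq)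
qed

lemma cos_ft_0_0: "cos_ft 0 0 = of_real pi"
  by (simp add: cos_ft_def scaleR_conv_of_real)

lemma cos_ft_0_pos: "\<exists>r>0. cos_ft q 0 = of_real r"
proof (induction q)
  case 0
  then show ?case by (auto simp: cos_ft_0_0 intro!: exI[of _ pi])
next
  case (Suc q)
  then obtain r where r: "r > 0" "cos_ft q 0 = of_real r" by auto
  define n where "n = real (2 * Suc q)"
  have n: "n > 1" by (simp add: n_def)
  have "complex_of_real (n\<^sup>2) * cos_ft (Suc q) 0 = complex_of_real (n * (n - 1)) * of_real r"
    using cos_ft_Suc[of q 0] r by (simp add: n_def)
  then have "cos_ft (Suc q) 0 = of_real (n * (n - 1) * r / n\<^sup>2)"
    using n by (simp add: field_simps)
  moreover have "n * (n - 1) * r / n\<^sup>2 > 0" using n r by simp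
  ultimately show ?case by blast
qed

lemma norm_cos_ft_le: "cmod (cos_ft q z) \<le> pi"
proof -
  have "cmod (cos_ft q z) \<le> integral {-(pi/2)..pi/2} (\<lambda>t. 1::real)"
    unfolding cos_ft_def
    by (intro integral_norm_bound_integral integrable_continuous_interval continuous_intros)
       (auto simp: norm_mult norm_power power_le_one_iff)
  then show ?thesis by simp
qed

lemma norm_cos_ft_decay:
  assumes "q \<le> P" "0 < P" "4 * real P \<le> \<bar>z\<bar>"
  shows "cmod (cos_ft q z) \<le> (16 * (real P)\<^sup>2 / (3 * z\<^sup>2)) ^ q * cmod (cos_ft q 0)"
  using assms(1)
proof (induction q)
  case 0
  then show ?case using norm_cos_ft_le[of 0 z] by (simp add: cos_ft_0_0)
next
  case (Suc q)
  define n where "n = real (2 * Suc q)"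
  have n: "n > 1" "n \<le> 2 * P" using Suc.prems by (auto simp: n_def)
  have z2: "16 * (real P)\<^sup>2 \<le> z\<^sup>2"
    using power_mono[OF assms(3), of 2] by (simp add: power_mult_distrib)
  have nP: "n\<^sup>2 \<le> 4 * (real P)\<^sup>2"
    using power_mono[OF n(2), of 2] n by (simp add: power_mult_distrib)
  have P0: "(real P)\<^sup>2 > 0" using assms by simp
  have z34: "3 * z\<^sup>2 / 4 \<le> z\<^sup>2 - n\<^sup>2" and zp: "z\<^sup>2 > 0" using z2 nP P0 by linarith+
  have a: "(z\<^sup>2 - n\<^sup>2) * cmod (cos_ft (Suc q) z) = n * (n - 1) * cmod (cos_ft q z)"
  proof -
    have "cmod (complex_of_real (n\<^sup>2 - z\<^sup>2) * cos_ft (Suc q) z)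
        = cmod (complex_of_real (n * (n - 1)) * cos_ft q z)"
      using cos_ft_Suc[of q z] by (simp add: n_def)
    then show ?thesis using n z34 zp
      by (simp only: norm_mult norm_of_real) simp
  qed
  have b: "n\<^sup>2 * cmod (cos_ft (Suc q) 0) = n * (n - 1) * cmod (cos_ft q 0)"
  proof -
    have "cmod (complex_of_real (n\<^sup>2) * cos_ft (Suc q) 0)
        = cmod (complex_of_real (n * (n - 1)) * cos_ft q 0)"
      using cos_ft_Suc[of q 0] by (simp add: n_def)
    then show ?thesis using n
      by (simp only: norm_mult norm_of_real) simp
  qed
  define x where "x = 16 * (real P)\<^sup>2 / (3 * z\<^sup>2)"
  have x: "x \<ge> 0" by (simp add: x_def)
  have "(3 * z\<^sup>2 / 4) * cmod (cos_ft (Suc q) z) \<le> (z\<^sup>2 - n\<^sup>2) * cmod (cos_ft (Suc q) z)"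
    using z34 by (intro mult_right_mono) auto
  also have "\<dots> = n * (n - 1) * cmod (cos_ft q z)" by (rule a)
  also have "\<dots> \<le> n * (n - 1) * (x ^ q * cmod (cos_ft q 0))"
    using Suc n by (intro mult_left_mono) (auto simp: x_def)
  also have "\<dots> = x ^ q * (n\<^sup>2 * cmod (cos_ft (Suc q) 0))" unfolding b by simp
  also have "\<dots> \<le> x ^ q * (4 * (real P)\<^sup>2 * cmod (cos_ft (Suc q) 0))"
    using nP x by (intro mult_left_mono mult_right_mono) auto
  finally have "cmod (cos_ft (Suc q) z)
      \<le> x ^ q * (4 * (real P)\<^sup>2 * cmod (cos_ft (Suc q) 0)) / (3 * z\<^sup>2 / 4)"
    using zp by (simp add: field_simps)
  also have "\<dots> = x ^ Suc q * cmod (cos_ft (Suc q) 0)"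
    using zp by (simp add: x_def field_simps)
  finally show ?case by (simp add: x_def)
qed

lemma cos_ft_1_decay: 
  assumes "z \<noteq> 0" shows "cmod (cos_ft 1 z) \<le> 6 * pi / z\<^sup>2"
proof -
  have "complex_of_real (z\<^sup>2) * cos_ft 1 z = 4 * cos_ft 1 z - 2 * cos_ft 0 z"
    using cos_ft_Suc[of 0 z] by (simp add: algebra_simps)
  then have "z\<^sup>2 * cmod (cos_ft 1 z) = cmod (4 * cos_ft 1 z - 2 * cos_ft 0 z)"
    by (metis norm_mult norm_of_real abs_of_nonneg zero_le_power2)
  also have "\<dots> \<le> 4 * cmod (cos_ft 1 z) + 2 * cmod (cos_ft 0 z)"
    by (rule order_trans[OF norm_triangle_ineq4]) (simp add: norm_mult)
  also have "\<dots> \<le> 6 * pi" using norm_cos_ft_le[of 1 z] norm_cos_ft_le[of 0 z] by linarith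
  finally show ?thesis using assms by (simp add: field_simps)
qed

lemma cos_ft_multiplier:
  assumes "finite S" "d > 0" "\<And>i. i \<in> S \<Longrightarrow> d \<le> \<bar>\<mu> i\<bar>" "card S < q" "q \<le> P"
  shows "\<exists>a :: nat \<Rightarrow> real. (\<forall>z. complex_of_real (\<Prod>i\<in>S. 1 - z\<^sup>2 / (\<mu> i)\<^sup>2) * cos_ft q z
              = (\<Sum>p\<le>P. of_real (a p) * cos_ft p z)) \<and>
            (\<Sum>p\<le>P. \<bar>a p\<bar>) \<le> (1 + 8 * (real P)\<^sup>2 / d\<^sup>2) ^ card S \<and> a 0 = 0"
  using assms(1,3-5)
proof (induction S arbitrary: q rule: finite_induct)
  case empty
  show ?case
    using empty by (intro exI[of _ "\<lambda>p. if p
        = q then 1 else 0"]) (auto simp: if_distrib if_distribR cong: if_cong)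
next
  case (insert i S)
  then obtain q' where q': "q = Suc q'" by (cases q) auto
  let ?B = "1 + 8 * (real P)\<^sup>2 / d\<^sup>2"
  define n where "n = real (2 * q)"
  define \<alpha> where "\<alpha> = 1 - n\<^sup>2 / (\<mu> i)\<^sup>2"
  define \<beta> where "\<beta> = n * (n - 1) / (\<mu> i)\<^sup>2"
  have \<mu>: "\<mu> i \<noteq> 0" "d\<^sup>2 \<le> (\<mu> i)\<^sup>2" using insert.prems(1)[of i] assms(2) power_mono[of d "\<bar>\<mu> i\<bar>" 2]
      by auto
  have c: "card S < q" "q \<le> P" "card S < q'" "q' \<le> P"
    using insert.prems insert.hyps q' by auto
  obtain a where a: "\<And>z. complex_of_real (\<Prod>i\<in>S. 1 - z\<^sup>2 / (\<mu> i)\<^sup>2) * cos_ft q z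
              = (\<Sum>p\<le>P. of_real (a p) * cos_ft p z)" "(\<Sum>p\<le>P. \<bar>a p\<bar>) \<le> ?B ^ card S" "a 0 = 0"
    using insert.IH[OF insert.prems(1)[OF insertI2] c(1,2)] by metis
  obtain b where b: "\<And>z. complex_of_real (\<Prod>i\<in>S. 1 - z\<^sup>2 / (\<mu> i)\<^sup>2) * cos_ft q' z
              = (\<Sum>p\<le>P. of_real (b p) * cos_ft p z)" "(\<Sum>p\<le>P. \<bar>b p\<bar>) \<le> ?B ^ card S" "b 0 = 0"
    using insert.IH[OF insert.prems(1)[OF insertI2] c(3,4)] by metis
  have n: "n \<ge> 1" "n \<le> 2 * P" using insert.prems q' by (auto simp: n_def)
  have nP: "n\<^sup>2 \<le> 4 * (real P)\<^sup>2"
    using power_mono[OF n(2), of 2] n by (simp add: power_mult_distrib)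
  have eq: "complex_of_real (1 - z\<^sup>2 / (\<mu> i)\<^sup>2) * cos_ft q z
      = of_real \<alpha> * cos_ft q z + of_real \<beta> * cos_ft q' z" for z
  proof -
    have "of_real (n\<^sup>2 - z\<^sup>2) * cos_ft q z = of_real (n * (n - 1)) * cos_ft q' z"
      using cos_ft_Suc[of q' z] by (simp add: n_def q')
    then have F: "of_real (1 / (\<mu> i)\<^sup>2) * (of_real (n\<^sup>2 - z\<^sup>2) * cos_ft q z)
        = of_real \<beta> * cos_ft q' z"
      by (simp add: \<beta>_def)
    have E: "(1 - z\<^sup>2 / (\<mu> i)\<^sup>2) = \<alpha> + 1 / (\<mu> i)\<^sup>2 * (n\<^sup>2 - z\<^sup>2)"
      by (simp add: \<alpha>_def diff_divide_distrib)
    show ?thesis by (simp only: E F of_real_add of_real_mult distrib_right mult.assoc)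
  qed
  have bound: "\<bar>\<alpha>\<bar> + \<bar>\<beta>\<bar> \<le> ?B"
  proof -
    have "n\<^sup>2 / (\<mu> i)\<^sup>2 \<le> 4 * (real P)\<^sup>2 / d\<^sup>2"
      using nP \<mu> assms(2) by (intro frac_le) auto
    moreover have "\<bar>\<beta>\<bar> \<le> n\<^sup>2 / (\<mu> i)\<^sup>2"
      using n by (simp add: \<beta>_def abs_mult power2_eq_square divide_right_mono)
    moreover have "\<bar>\<alpha>\<bar> \<le> 1 + n\<^sup>2 / (\<mu> i)\<^sup>2"
      unfolding \<alpha>_def by (rule order_trans[OF abs_triangle_ineq4]) simp
    ultimately show ?thesis by simp
  qed
  show ?case
  proof (intro exI[of _ "\<lambda>p. \<alpha> * a p + \<beta> * b p"] conjI allI)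
    fix z
    have "complex_of_real (\<Prod>i\<in>insert i S. 1 - z\<^sup>2 / (\<mu> i)\<^sup>2) * cos_ft q z
       = complex_of_real (\<Prod>i\<in>S. 1 - z\<^sup>2 / (\<mu> i)\<^sup>2) * (complex_of_real (1 - z\<^sup>2 / (\<mu> i)\<^sup>2) *
           cos_ft q z)"
      using insert by simp
    also have "\<dots> = of_real \<alpha> * (complex_of_real (\<Prod>i\<in>S. 1 - z\<^sup>2 / (\<mu> i)\<^sup>2) * cos_ft q z)
       + of_real \<beta> * (complex_of_real (\<Prod>i\<in>S. 1 - z\<^sup>2 / (\<mu> i)\<^sup>2) * cos_ft q' z)"
      unfolding eq by (simp add: algebra_simps)
    also have "\<dots> = (\<Sum>p\<le>P. of_real (\<alpha> * a p + \<beta> * b p) * cos_ft p z)"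
      unfolding a b by (simp add: sum_distrib_left sum.distrib algebra_simps)
    finally show "complex_of_real (\<Prod>i\<in>insert i S. 1 - z\<^sup>2 / (\<mu> i)\<^sup>2) * cos_ft q z = \<dots>" .
  next
    have "(\<Sum>p\<le>P. \<bar>\<alpha> * a p + \<beta> * b p\<bar>) \<le> (\<Sum>p\<le>P. \<bar>\<alpha>\<bar> * \<bar>a p\<bar> + \<bar>\<beta>\<bar> * \<bar>b p\<bar>)"
      by (intro sum_mono) (metis abs_mult abs_triangle_ineq)
    also have "\<dots> = \<bar>\<alpha>\<bar> * (\<Sum>p\<le>P. \<bar>a p\<bar>) + \<bar>\<beta>\<bar> * (\<Sum>p\<le>P. \<bar>b p\<bar>)"
      by (simp add: sum.distrib sum_distrib_left)
    also have "\<dots> \<le> \<bar>\<alpha>\<bar> * ?B ^ card S + \<bar>\<beta>\<bar> * ?B ^ card S"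
      using a b by (intro add_mono mult_left_mono) auto
    also have "\<dots> = (\<bar>\<alpha>\<bar> + \<bar>\<beta>\<bar>) * ?B ^ card S" by (simp add: algebra_simps)
    also have "\<dots> \<le> ?B * ?B ^ card S"
      using bound by (intro mult_right_mono) auto
    finally show "(\<Sum>p\<le>P. \<bar>\<alpha> * a p + \<beta> * b p\<bar>) \<le> ?B ^ card (insert i S)"
      using insert by simp
    show "\<alpha> * a 0 + \<beta> * b 0 = 0" using a b by simp
  qed
qed

subsection \<open>Separated sets\<close>

lemma separated_card_le:
  fixes T :: "real set"
  assumes "finite T" "T \<noteq> {}" "\<And>x y. x \<in> T \<Longrightarrow> y \<in> T \<Longrightarrow> x \<noteq> y \<Longrightarrow> d \<le> \<bar>x - y\<bar>"
  shows "(real (card T) - 1) * d \<le> Max T - Min T"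
  using assms
proof (induction T rule: finite_linorder_max_induct)
  case empty
  then show ?case by simp
next
  case (insert b A)
  show ?case
  proof (cases "A = {}")
    case False
    have "Max A \<in> A" using False insert by simp
    then have "Max A < b" "d \<le> \<bar>b - Max A\<bar>" using insert by auto
    moreover have "(real (card A) - 1) * d \<le> Max A - Min A"
      using insert False by auto
    moreover have "Max (insert b A) = b"
      using insert False by (intro Max_eqI) (auto intro: less_imp_le)
    moreover have "Min (insert b A) = Min A"
    proof -
      have "Min A \<in> A" using False insert by simp
      then show ?thesis using insert False by (simp add: min_def) force
    qed
    moreover have "card (insert b A) = Suc (card A)" using insert by auto
    ultimately show ?thesis by (simp add: algebra_simps)
  qed simp
qed

lemma separated_enumeration:
  fixes \<mu> :: "'i \<Rightarrow> real"
  assumes "finite S" "d > 0" "\<And>i. i \<in> S \<Longrightarrow> d \<le> \<bar>\<mu> i\<bar>"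
    "\<And>i j. i \<in> S \<Longrightarrow> j \<in> S \<Longrightarrow> i \<noteq> j \<Longrightarrow> d \<le> \<bar>\<mu> i - \<mu> j\<bar>"
  shows "\<exists>e. bij_betw e {1..card S} S \<and> (\<forall>n\<in>{1..card S}. real n * (d / 2) \<le> \<bar>\<mu> (e n)\<bar>)"
  using assms(1,3,4)
proof (induction "card S" arbitrary: S)
  case 0
  then show ?case by (auto simp: bij_betw_def)
next
  case (Suc n)
  then have ne: "S \<noteq> {}" by auto
  define x where "x = Max ((\<lambda>i. \<bar>\<mu> i\<bar>) ` S)"
  have "x \<in> (\<lambda>i. \<bar>\<mu> i\<bar>) ` S" unfolding x_def using ne Suc by (intro Max_in) auto
  then obtain m where m: "m \<in> S" "\<bar>\<mu> m\<bar> = x" by auto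
  have le: "\<bar>\<mu> i\<bar> \<le> x" if "i \<in> S" for i unfolding x_def using Suc that by (intro Max_ge) auto
  define T where "T = insert 0 (\<mu> ` S)"
  have inj: "inj_on \<mu> S" using Suc.prems(3) assms(2) by (force simp: inj_on_def)
  have 0: "0 \<notin> \<mu> ` S" using Suc.prems(2) assms(2) by force
  have cT: "card T = Suc (card S)" using inj 0 Suc.prems by (simp add: T_def card_image)
  have T: "finite T" "T \<noteq> {}" using Suc.prems by (auto simp: T_def)
  have "(real (card T) - 1) * d \<le> Max T - Min T"
  proof (rule separated_card_le[OF T])
    fix x y assume "x \<in> T" "y \<in> T" "x \<noteq> y"
    then consider "x = 0" "y \<in> \<mu> ` S" | "y = 0" "x \<in> \<mu> ` S" | "x \<in> \<mu> ` S" "y \<in> \<mu> ` S"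
      by (auto simp: T_def)
    then show "d \<le> \<bar>x - y\<bar>"
    proof cases
      case 3
      then obtain i j where "x = \<mu> i" "y = \<mu> j" "i \<in> S" "j \<in> S" by auto
      then show ?thesis using Suc.prems(3)[of i j] \<open>x \<noteq> y\<close> by auto
    qed (use Suc.prems(2) in auto)
  qed
  moreover have T_le: "\<bar>t\<bar> \<le> x" if "t \<in> T" for t
    using that le m by (auto simp: T_def)
  have "\<bar>Max T\<bar> \<le> x" "\<bar>Min T\<bar> \<le> x" using T_le[OF Max_in[OF T]] T_le[OF Min_in[OF T]] by auto
  ultimately have x: "real (card S) * (d / 2) \<le> x" using cT by (simp add: abs_le_iff)
  have cS: "n = card (S - {m})" using Suc.hyps Suc.prems m by simp
  obtain e where e: "bij_betw e {1..n} (S - {m})" "\<And>k. k \<in> {1..n} \<Longrightarrow> real k * (d / 2) \<le> \<bar>\<mu> (e k)\<bar>"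
    using Suc.hyps(1)[OF cS] Suc.prems cS by (metis DiffD1 finite_Diff)
  have "bij_betw (e(Suc n := m)) ({1..n} \<union> {Suc n}) ((S - {m}) \<union> {m})"
  proof (rule bij_betw_combine)
    show "bij_betw (e(Suc n := m)) {1..n} (S - {m})"
      using e(1) by (subst bij_betw_cong[of _ _ e]) auto
  qed auto
  moreover have "{1..n} \<union> {Suc n} = {1..card S}" using Suc.hyps(2) by auto
  moreover have "(S - {m}) \<union> {m} = S" using m by auto
  ultimately have "bij_betw (e(Suc n := m)) {1..card S} S" by simp
  moreover have "\<forall>k\<in>{1..card S}. real k * (d / 2) \<le> \<bar>\<mu> ((e(Suc n := m)) k)\<bar>"
    using e(2) x m Suc.hyps(2) by (auto simp: le_Suc_eq)
  ultimately show ?case by blast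
qed

lemma separated_prod_ge:
  fixes \<mu> :: "'i \<Rightarrow> real"
  assumes "finite S" "d > 0" "\<And>i. i \<in> S \<Longrightarrow> d \<le> \<bar>\<mu> i\<bar>"
    "\<And>i j. i \<in> S \<Longrightarrow> j \<in> S \<Longrightarrow> i \<noteq> j \<Longrightarrow> d \<le> \<bar>\<mu> i - \<mu> j\<bar>"
  shows "(d / 2) ^ card S * fact (card S) \<le> (\<Prod>i\<in>S. \<bar>\<mu> i\<bar>)"
proof -
  obtain e where e: "bij_betw e {1..card S} S" "\<And>n. n\<in>{1..card S} \<Longrightarrow> real n * (d / 2) \<le> \<bar>\<mu> (e n)\<bar>"
    using separated_enumeration[where \<mu> = \<mu>, OF assms] by blast
  have "(d / 2) ^ card S * fact (card S) = (\<Prod>n\<in>{1..card S}. real n * (d / 2))"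
    by (simp only: prod.distrib prod_constant fact_prod card_atLeastAtMost) simp
  also have "\<dots> \<le> (\<Prod>n\<in>{1..card S}. \<bar>\<mu> (e n)\<bar>)"
    using e assms(2) by (intro prod_mono) auto
  also have "\<dots> = (\<Prod>i\<in>S. \<bar>\<mu> i\<bar>)"
    using prod.reindex_bij_betw[OF e(1), of "\<lambda>i. \<bar>\<mu> i\<bar>"] by simp
  finally show ?thesis .
qed

lemma sum_inverse_squares_le: "(\<Sum>n=1..m. 1 / (real n)\<^sup>2) \<le> 2 - 1 / real m"
proof (induction m)
  case (Suc m)
  show ?case
  proof (cases m)
    case (Suc k)
    have "1 / (real (Suc m))\<^sup>2 \<le> 1 / (real m * real (Suc m))"
      using Suc by (intro divide_left_mono) (auto simp: power2_eq_square)
    also have "\<dots> = 1 / real m - 1 / real (Suc m)" using Suc by (simp add: field_simps)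
    finally show ?thesis using Suc.IH by simp
  qed simp
qed simp


lemma separated_sum_inverse_squares_le:
  fixes \<mu> :: "'i \<Rightarrow> real"
  assumes "finite S" "d > 0" "\<And>i. i \<in> S \<Longrightarrow> d \<le> \<bar>\<mu> i\<bar>"
    "\<And>i j. i \<in> S \<Longrightarrow> j \<in> S \<Longrightarrow> i \<noteq> j \<Longrightarrow> d \<le> \<bar>\<mu> i - \<mu> j\<bar>"
  shows "(\<Sum>i\<in>S. 1 / (\<mu> i)\<^sup>2) \<le> 8 / d\<^sup>2"
proof -
  obtain e where e: "bij_betw e {1..card S} S" "\<And>n. n\<in>{1..card S} \<Longrightarrow> real n * (d / 2) \<le> \<bar>\<mu> (e n)\<bar>"
    using separated_enumeration[where \<mu> = \<mu>, OF assms] by blast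
  have "(\<Sum>i\<in>S. 1 / (\<mu> i)\<^sup>2) = (\<Sum>n\<in>{1..card S}. 1 / (\<mu> (e n))\<^sup>2)"
    using sum.reindex_bij_betw[OF e(1), of "\<lambda>i. 1 / (\<mu> i)\<^sup>2"] by simp
  also have "\<dots> \<le> (\<Sum>n\<in>{1..card S}. 4 / d\<^sup>2 * (1 / (real n)\<^sup>2))"
  proof (rule sum_mono)
    fix n assume n: "n \<in> {1..card S}"
    have "(real n * (d / 2))\<^sup>2 \<le> (\<mu> (e n))\<^sup>2"
      using power_mono[OF e(2)[OF n], of 2] n assms(2) by simp
    moreover have "(real n * (d / 2))\<^sup>2 > 0" using n assms(2) by simp
    ultimately have "1 / (\<mu> (e n))\<^sup>2 \<le> 1 / (real n * (d / 2))\<^sup>2"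
      by (intro frac_le) auto
    then show "1 / (\<mu> (e n))\<^sup>2 \<le> 4 / d\<^sup>2 * (1 / (real n)\<^sup>2)"
      by (simp add: power_mult_distrib power_divide mult.commute)
  qed
  also have "\<dots> = 4 / d\<^sup>2 * (\<Sum>n=1..card S. 1 / (real n)\<^sup>2)" by (simp add: sum_distrib_left)
  also have "\<dots> \<le> 4 / d\<^sup>2 * 2"
    using sum_inverse_squares_le[of "card S"] by (intro mult_left_mono) (auto intro: order_trans)
  finally show ?thesis by simp
qed

lemma symmetric_bilinear_le:
  fixes m :: "'i \<Rightarrow> 'i \<Rightarrow> real"
  assumes "\<And>k j. k \<in> K \<Longrightarrow> j \<in> K \<Longrightarrow> m k j = m j k" "\<And>k j. k \<in> K \<Longrightarrow> j \<in> K \<Longrightarrow> 0 \<le> m k j"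
    "\<And>k. k \<in> K \<Longrightarrow> (\<Sum>j\<in>K. m k j) \<le> r"
  shows "(\<Sum>k\<in>K. \<Sum>j\<in>K. x k * x j * m k j) \<le> r * (\<Sum>k\<in>K. (x k)\<^sup>2)"
proof -
  have "(\<Sum>k\<in>K. \<Sum>j\<in>K. x k * x j * m k j) \<le> (\<Sum>k\<in>K. \<Sum>j\<in>K. (x k)\<^sup>2 * m k j / 2 + (x j)\<^sup>2 * m k j / 2)"
  proof (intro sum_mono)
    fix k j assume "k \<in> K" "j \<in> K"
    have "2 * (x k * x j) \<le> (x k)\<^sup>2 + (x j)\<^sup>2" using sum_squares_bound[of "x k" "x j"] by simp
    from mult_right_mono[OF this assms(2)[OF \<open>k \<in> K\<close> \<open>j \<in> K\<close>]]
    show "x k * x j * m k j \<le> (x k)\<^sup>2 * m k j / 2 + (x j)\<^sup>2 * m k j / 2"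
      by (simp add: algebra_simps)
  qed
  also have "\<dots> = (\<Sum>k\<in>K. \<Sum>j\<in>K. (x k)\<^sup>2 * m k j / 2) + (\<Sum>j\<in>K. \<Sum>k\<in>K. (x j)\<^sup>2 * m k j / 2)"
    by (subst sum.swap[of "\<lambda>j k. (x j)\<^sup>2 * m k j / 2"]) (simp add: sum.distrib)
  also have "(\<Sum>j\<in>K. \<Sum>k\<in>K. (x j)\<^sup>2 * m k j / 2) = (\<Sum>k\<in>K. \<Sum>j\<in>K. (x k)\<^sup>2 * m k j / 2)"
    by (intro sum.cong refl) (simp add: assms(1))
  also have "(\<Sum>k\<in>K. \<Sum>j\<in>K. (x k)\<^sup>2 * m k j / 2) + (\<Sum>k\<in>K. \<Sum>j\<in>K. (x k)\<^sup>2 * m k j / 2)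
      = (\<Sum>k\<in>K. (x k)\<^sup>2 * (\<Sum>j\<in>K. m k j))"
    by (simp add: sum_distrib_left flip: sum.distrib) (simp add: mult.commute)
  also have "\<dots> \<le> (\<Sum>k\<in>K. (x k)\<^sup>2 * r)"
    by (intro sum_mono mult_left_mono assms(3)) auto
  also have "\<dots> = r * (\<Sum>k\<in>K. (x k)\<^sup>2)" by (simp add: sum_distrib_left mult.commute)
  finally show ?thesis .
qed

abbreviation exp_sum :: "'i set \<Rightarrow> ('i \<Rightarrow> complex) \<Rightarrow> ('i \<Rightarrow> real) \<Rightarrow> real \<Rightarrow> complex" where
  "exp_sum K c l t \<equiv> (\<Sum>k\<in>K. c k * cis (l k * t))"

lemma cos_ft_has_integral:
  "((\<lambda>t. complex_of_real (cos t ^ (2 * q)) * cis (z * t)) has_integral cos_ft q z) {-(pi/2)..pi/2}"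
  unfolding cos_ft_def by (intro integrable_integral integrable_continuous_interval
      continuous_intros)

lemma norm_exp_sum_square:
  assumes "finite K"
  shows "complex_of_real ((cmod (exp_sum K c l t))\<^sup>2)
      = (\<Sum>k\<in>K. \<Sum>j\<in>K. c k * cnj (c j) * cis ((l k - l j) * t))"
proof -
  have "cis ((l k - l j) * t) = cis (l k * t) * cnj (cis (l j * t))" for k j
    by (simp add: cis_cnj cis_mult algebra_simps)
  then show ?thesis
    unfolding complex_norm_square by (simp add: sum_product mult_ac)
qed

lemma integral_cos_square_exp_sum_le:
  assumes "finite K" "d > 0" "\<And>i j. i \<in> K \<Longrightarrow> j \<in> K \<Longrightarrow> i \<noteq> j \<Longrightarrow> d \<le> \<bar>l i - l j\<bar>"
  shows "integral {-(pi/2)..pi/2} (\<lambda>t. (cos t)\<^sup>2 * (cmod (exp_sum K c l t))\<^sup>2)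
    \<le> (pi + 48 * pi / d\<^sup>2) * (\<Sum>k\<in>K. (cmod (c k))\<^sup>2)"
proof -
  let ?I = "{-(pi/2)..pi/2}"
  let ?f = "\<lambda>t. (cos t)\<^sup>2 * (cmod (exp_sum K c l t))\<^sup>2"
  define m where "m = (\<lambda>k j. cmod (cos_ft 1 (l k - l j)))"
  have "((\<lambda>t. complex_of_real (?f t)) has_integral of_real (integral ?I ?f)) ?I"
    by (intro has_integral_of_real integrable_integral integrable_continuous_interval
        continuous_intros)
  moreover have "((\<lambda>t. \<Sum>k\<in>K. \<Sum>j\<in>K. c k * cnj (c j) * (of_real (cos t ^ (2 * 1)) * cis ((l k - l j) *
      t)))
      has_integral (\<Sum>k\<in>K. \<Sum>j\<in>K. c k * cnj (c j) * cos_ft 1 (l k - l j))) ?I"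
    by (intro has_integral_sum assms(1) has_integral_mult_right cos_ft_has_integral)
  moreover have "complex_of_real (?f t)
      = (\<Sum>k\<in>K. \<Sum>j\<in>K. c k * cnj (c j) * (of_real (cos t ^ (2 * 1)) * cis ((l k - l j) * t)))" for t
    by (simp only: of_real_mult norm_exp_sum_square[OF assms(1)] sum_distrib_left) (simp add:
        mult_ac)
  ultimately have eq: "of_real (integral ?I ?f)
      = (\<Sum>k\<in>K. \<Sum>j\<in>K. c k * cnj (c j) * cos_ft 1 (l k - l j))"
    by (simp only:) (rule has_integral_unique)
  have "integral ?I ?f \<le> cmod (of_real (integral ?I ?f))" by (simp only: norm_of_real abs_ge_self)
  also have "\<dots> = cmod (\<Sum>k\<in>K. \<Sum>j\<in>K. c k * cnj (c j) * cos_ft 1 (l k - l j))" by (simp only: eq)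
  also have "\<dots> \<le> (\<Sum>k\<in>K. \<Sum>j\<in>K. cmod (c k) * cmod (c j) * m k j)"
    by (intro sum_norm_le) (simp add: m_def norm_mult)
  also have "\<dots> \<le> (pi + 48 * pi / d\<^sup>2) * (\<Sum>k\<in>K. (cmod (c k))\<^sup>2)"
  proof -
    define m' where "m' = (\<lambda>k j. if k = j then pi else 6 * pi / (l k - l j)\<^sup>2)"
    have "(\<Sum>k\<in>K. \<Sum>j\<in>K. cmod (c k) * cmod (c j) * m k j)
        \<le> (\<Sum>k\<in>K. \<Sum>j\<in>K. cmod (c k) * cmod (c j) * m' k j)"
    proof (intro sum_mono mult_left_mono)
      fix k j assume kj: "k \<in> K" "j \<in> K"
      show "m k j \<le> m' k j"
        using norm_cos_ft_le[of 1 0] cos_ft_1_decay[of "l k - l j"] assms(2) assms(3)[OF kj]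
        by (auto simp: m_def m'_def)
    qed auto
    also have "\<dots> \<le> (pi + 48 * pi / d\<^sup>2) * (\<Sum>k\<in>K. (cmod (c k))\<^sup>2)"
    proof (rule symmetric_bilinear_le)
      fix k assume k: "k \<in> K"
      have "(\<Sum>j\<in>K. m' k j) = m' k k + (\<Sum>j\<in>K - {k}. m' k j)"
        by (rule sum.remove) (use assms k in auto)
      also have "(\<Sum>j\<in>K - {k}. m' k j) = (\<Sum>j\<in>K - {k}. 6 * pi * (1 / (l k - l j)\<^sup>2))"
        by (intro sum.cong) (auto simp: m'_def)
      also have "\<dots> = 6 * pi * (\<Sum>j\<in>K - {k}. 1 / (l k - l j)\<^sup>2)"
        by (simp only: sum_distrib_left)
      also have "(\<Sum>j\<in>K - {k}. 1 / (l k - l j)\<^sup>2) \<le> 8 / d\<^sup>2"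
      proof (rule separated_sum_inverse_squares_le)
        show "d \<le> \<bar>l k - l i\<bar>" if "i \<in> K - {k}" for i using that assms(3)[of k i] k by auto
        show "d \<le> \<bar>(l k - l i) - (l k - l j)\<bar>" if "i \<in> K - {k}" "j \<in> K - {k}" "i \<noteq> j" for i j
          using that assms(3)[of i j] by auto
      qed (use assms in auto)
      finally show "(\<Sum>j\<in>K. m' k j) \<le> pi + 48 * pi / d\<^sup>2" by (simp add: m'_def)
    qed (auto simp: m'_def power2_commute)
    finally show ?thesis .
  qed
  finally show ?thesis .
qed

lemma sum_norm_square_cos_coeff_le:
  fixes F :: "real \<Rightarrow> complex"
  assumes "finite K" "d > 0" "\<And>i j. i \<in> K \<Longrightarrow> j \<in> K \<Longrightarrow> i \<noteq> j \<Longrightarrow> d \<le> \<bar>l i - l j\<bar>"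
    and F: "continuous_on {-(pi/2)..pi/2} F" and q: "q \<ge> 1"
  defines "b \<equiv> \<lambda>k. integral {-(pi/2)..pi/2} (\<lambda>t. F t * (of_real (cos t ^ (2 * q)) * cis (- l k *
      t)))"
  shows "(\<Sum>k\<in>K. (cmod (b k))\<^sup>2) \<le> (pi + 48 * pi / d\<^sup>2) *
      integral {-(pi/2)..pi/2} (\<lambda>t. (cmod (F t))\<^sup>2)"
proof -
  let ?I = "{-(pi/2)..pi/2}"
  let ?G = "exp_sum K b l"
  define C where "C = pi + 48 * pi / d\<^sup>2"
  have C: "C > 0" using assms(2) by (simp add: C_def add_pos_nonneg)
  define s where "s = (\<Sum>k\<in>K. (cmod (b k))\<^sup>2)"
  have "((\<lambda>t. \<Sum>k\<in>K. cnj (b k) * (F t * (of_real (cos t ^ (2 * q)) * cis (- l k * t))))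
      has_integral (\<Sum>k\<in>K. cnj (b k) * b k)) ?I"
    unfolding b_def
    by (intro has_integral_sum assms(1) has_integral_mult_right integrable_integral
        integrable_continuous_interval continuous_intros F)
  moreover have "(\<Sum>k\<in>K. cnj (b k) * b k) = of_real s"
    by (simp only: s_def of_real_sum complex_norm_square mult.commute)
  moreover have "(\<Sum>k\<in>K. cnj (b k) * (F t * (of_real (cos t ^ (2 * q)) * cis (- l k * t))))
      = F t * of_real (cos t ^ (2 * q)) * cnj (?G t)" for t
    by (simp add: sum_distrib_left cis_cnj mult_ac)
  ultimately have "((\<lambda>t. F t * of_real (cos t ^ (2 * q)) * cnj (?G t)) has_integral of_real s) ?I"
    by simp
  then have "cmod (of_real s) = cmod (integral ?I (\<lambda>t. F t * of_real (cos t ^ (2 * q)) *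
      cnj (?G t)))"
    by (simp add: integral_unique)
  also have "\<dots> \<le> integral ?I (\<lambda>t. C / 2 * (cmod (F t))\<^sup>2 + 1 / (2 * C) * ((cos t)\<^sup>2 *
      (cmod (?G t))\<^sup>2))"
  proof (intro integral_norm_bound_integral integrable_continuous_interval continuous_intros F)
    fix t :: real
    have "\<bar>cos t\<bar> ^ (2 * q) \<le> \<bar>cos t\<bar> ^ 1" using q by (intro power_decreasing) auto
    then have "cmod (F t) * \<bar>cos t\<bar> ^ (2 * q) * cmod (?G t) \<le> cmod (F t) * (\<bar>cos t\<bar> * cmod (?G t))"
      unfolding mult.assoc by (intro mult_left_mono mult_right_mono) auto
    also have "\<dots> \<le> C / 2 * (cmod (F t))\<^sup>2 + 1 / (2 * C) * (\<bar>cos t\<bar> * cmod (?G t))\<^sup>2"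
    proof -
      have "0 \<le> (C * cmod (F t) - \<bar>cos t\<bar> * cmod (?G t))\<^sup>2" by simp
      then have "2 * C * (cmod (F t) * (\<bar>cos t\<bar> * cmod (?G t)))
          \<le> C\<^sup>2 * (cmod (F t))\<^sup>2 + (\<bar>cos t\<bar> * cmod (?G t))\<^sup>2"
        by (simp add: power2_diff power_mult_distrib)
      then have "2 * C * (cmod (F t) * (\<bar>cos t\<bar> * cmod (?G t))) / (2 * C)
          \<le> (C\<^sup>2 * (cmod (F t))\<^sup>2 + (\<bar>cos t\<bar> * cmod (?G t))\<^sup>2) / (2 * C)"
        using C by (intro divide_right_mono) auto
      then show ?thesis using C by (simp add: add_divide_distrib power2_eq_square)
    qed
    finally show "cmod (F t * of_real (cos t ^ (2 * q)) * cnj (?G t))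
        \<le> C / 2 * (cmod (F t))\<^sup>2 + 1 / (2 * C) * ((cos t)\<^sup>2 * (cmod (?G t))\<^sup>2)"
      by (simp add: norm_mult norm_power power_mult_distrib del: cnj_sum)
  qed
  also have "\<dots> = C / 2 * integral ?I (\<lambda>t. (cmod (F t))\<^sup>2) + 1 / (2 * C) *
      integral ?I (\<lambda>t. (cos t)\<^sup>2 * (cmod (?G t))\<^sup>2)"
    using C by (subst integral_add) (auto intro!: integrable_continuous_interval continuous_intros
        F)
  also have "\<dots> \<le> C / 2 * integral ?I (\<lambda>t. (cmod (F t))\<^sup>2) + 1 / (2 * C) * (C * s)"
    using integral_cos_square_exp_sum_le[where c = b, OF assms(1-3)] C
    by (intro add_left_mono mult_left_mono) (auto simp: C_def s_def)
  also have "\<dots> = C / 2 * integral ?I (\<lambda>t. (cmod (F t))\<^sup>2) + s / 2" using C by simp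
  finally have "\<bar>s\<bar> \<le> C / 2 * integral ?I (\<lambda>t. (cmod (F t))\<^sup>2) + s / 2" by simp
  then have "s \<le> C * integral ?I (\<lambda>t. (cmod (F t))\<^sup>2)" using abs_ge_self[of s] by linarith
  then show ?thesis by (simp add: s_def C_def)
qed

subsection \<open>Lower bounds for exponential sums\<close>

lemma norm_near_multiplier_le:
  fixes \<mu> :: "'i \<Rightarrow> real"
  assumes S: "finite S" "d > 0" "\<And>i. i \<in> S \<Longrightarrow> d \<le> \<bar>\<mu> i\<bar>"
    "\<And>i j. i \<in> S \<Longrightarrow> j \<in> S \<Longrightarrow> i \<noteq> j \<Longrightarrow> d \<le> \<bar>\<mu> i - \<mu> j\<bar>"
    and near: "\<And>i. i \<in> S \<Longrightarrow> \<bar>\<mu> i\<bar> \<le> 4 * real P"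
    and P: "card S < P" "((8 * real P / d) ^ card S / fact (card S))\<^sup>2 \<le> (3/2) ^ P"
    and w: "4 * real P < \<bar>w\<bar>"
  shows "cmod (of_real (\<Prod>i\<in>S. 1 - w\<^sup>2 / (\<mu> i)\<^sup>2) * cos_ft P w)
      \<le> 16 * (real P)\<^sup>2 * (1/2) ^ P / w\<^sup>2 * cmod (cos_ft P 0)"
proof -
  define N where "N = card S"
  define R where "R = 4 * real P"
  have R: "R > 0" "R \<le> \<bar>w\<bar>" using P w by (auto simp: R_def)
  have pow8: "(2::real) ^ N * 4 ^ N = 8 ^ N" by (simp flip: power_mult_distrib)
  have "\<bar>\<Prod>i\<in>S. 1 - w\<^sup>2 / (\<mu> i)\<^sup>2\<bar> \<le> (\<Prod>i\<in>S. (\<bar>w\<bar> / \<bar>\<mu> i\<bar>)\<^sup>2)"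
    unfolding abs_prod
  proof (intro prod_mono conjI)
    fix i assume i: "i \<in> S"
    have "(\<mu> i)\<^sup>2 \<le> w\<^sup>2" using near[OF i] w by (intro abs_le_square_iff[THEN iffD1]) auto
    moreover have "(\<mu> i)\<^sup>2 > 0" using S(2) S(3)[OF i] by auto
    ultimately have "1 \<le> w\<^sup>2 / (\<mu> i)\<^sup>2" by simp
    then show "\<bar>1 - w\<^sup>2 / (\<mu> i)\<^sup>2\<bar> \<le> (\<bar>w\<bar> / \<bar>\<mu> i\<bar>)\<^sup>2" by (simp add: power_divide)
  qed simp
  also have "\<dots> = (\<bar>w\<bar> ^ N / (\<Prod>i\<in>S. \<bar>\<mu> i\<bar>))\<^sup>2"
    by (simp add: prod_dividef prod_power_distrib[symmetric] N_def)
  also have "\<dots> \<le> (\<bar>w\<bar> ^ N / ((d / 2) ^ N * fact N))\<^sup>2"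
    using separated_prod_ge[where \<mu> = \<mu>, OF S] S(2) unfolding N_def
    by (intro power_mono divide_left_mono) (auto intro!: mult_pos_pos prod_pos divide_nonneg_nonneg
        prod_nonneg simp: S(3) dest: S(3))
  also have "\<bar>w\<bar> ^ N / ((d / 2) ^ N * fact N) = (\<bar>w\<bar> / R) ^ N * ((8 * real P / d) ^ N / fact N)"
    using R(1) S(2) P pow8 by (simp add: R_def field_simps power_divide power_mult_distrib flip:
        power_mult)
  also have "(\<dots>)\<^sup>2 \<le> (\<bar>w\<bar> / R) ^ (2 * N) * (3/2) ^ P"
    unfolding power_mult_distrib power_mult[symmetric] using P(2) R
    by (intro mult_mono) (auto simp: N_def mult.commute)
  finally have 1: "\<bar>\<Prod>i\<in>S. 1 - w\<^sup>2 / (\<mu> i)\<^sup>2\<bar> \<le> (\<bar>w\<bar> / R) ^ (2 * N) * (3/2) ^ P" .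
  have 2: "cmod (cos_ft P w) \<le> (R\<^sup>2 / (3 * w\<^sup>2)) ^ P * cmod (cos_ft P 0)"
    using norm_cos_ft_decay[of P P w] P w by (simp add: R_def power_mult_distrib)
  have "(\<bar>w\<bar> / R) ^ (2 * N) * (3/2) ^ P * (R\<^sup>2 / (3 * w\<^sup>2)) ^ P \<le> R\<^sup>2 * (1/2) ^ P / w\<^sup>2"
  proof -
    define u where "u = R\<^sup>2 / w\<^sup>2"
    have w0: "w\<^sup>2 > 0" using w by auto
    have u: "0 < u" "u \<le> 1"
      using R w0 by (auto simp: u_def abs_le_square_iff[symmetric])
    have A: "(\<bar>w\<bar> / R) ^ (2 * N) = (1 / u) ^ N"
      by (simp add: power_mult u_def power_divide)
    have B: "(R\<^sup>2 / (3 * w\<^sup>2)) ^ P = (1/3) ^ P * u ^ P"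
      by (simp add: u_def power_divide power_mult_distrib)
    have "P = N + (P - N - 1 + 1)" using P by (simp add: N_def)
    then have C: "u ^ P = u ^ N * (u ^ (P - N - 1) * u)"
      by (metis power_add power_one_right)
    have D: "(3/2) ^ P * (1/3) ^ P = (1/2::real) ^ P" by (simp flip: power_mult_distrib)
    have E: "(1 / u) ^ N * u ^ N = 1" using u by (simp flip: power_mult_distrib)
    have "(\<bar>w\<bar> / R) ^ (2 * N) * (3/2) ^ P * (R\<^sup>2 / (3 * w\<^sup>2)) ^ P
        = ((3/2) ^ P * (1/3) ^ P) * ((1 / u) ^ N * u ^ N) * (u ^ (P - N - 1) * u)"
      unfolding A B C by (simp only: mult_ac)
    also have "\<dots> = (1/2) ^ P * (u ^ (P - N - 1) * u)" by (simp only: D E mult_1_right)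
    also have "\<dots> \<le> (1/2) ^ P * (1 * u)"
      using u by (intro mult_left_mono mult_right_mono power_le_one) auto
    finally show ?thesis by (simp add: u_def mult.commute)
  qed
  then have "(\<bar>w\<bar> / R) ^ (2 * N) * (3/2) ^ P * (R\<^sup>2 / (3 * w\<^sup>2)) ^ P * cmod (cos_ft P 0)
      \<le> R\<^sup>2 * (1/2) ^ P / w\<^sup>2 * cmod (cos_ft P 0)"
    by (rule mult_right_mono) simp
  moreover have "cmod (of_real (\<Prod>i\<in>S. 1 - w\<^sup>2 / (\<mu> i)\<^sup>2) * cos_ft P w)
      \<le> ((\<bar>w\<bar> / R) ^ (2 * N) * (3/2) ^ P) * ((R\<^sup>2 / (3 * w\<^sup>2)) ^ P * cmod (cos_ft P 0))"
    unfolding norm_mult norm_of_real using 1 2 R by (intro mult_mono) auto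
  ultimately show ?thesis by (simp add: R_def power_mult_distrib mult.assoc)
qed

lemma exp_sum_lower_bound_aux:
  assumes K: "finite K" "d > 0" "\<And>i j. i \<in> K \<Longrightarrow> j \<in> K \<Longrightarrow> i \<noteq> j \<Longrightarrow> d \<le> \<bar>l i - l j\<bar>"
    and count: "\<And>k. k \<in> K \<Longrightarrow> card {j \<in> K - {k}. \<bar>l j - l k\<bar> \<le> 4 * real P} \<le> N"
    and P: "N < P" "\<And>n. n \<le> N \<Longrightarrow> ((8 * real P / d) ^ n / fact n)\<^sup>2 \<le> (3/2) ^ P"
      "16 * (real P)\<^sup>2 * (1/2) ^ P * (8 / d\<^sup>2) \<le> 1/2"
  shows "(\<Sum>k\<in>K. (cmod (c k))\<^sup>2)
    \<le> (4 / (cmod (cos_ft P 0))\<^sup>2 * ((1 + 8 * (real P)\<^sup>2 / d\<^sup>2) ^ P)\<^sup>2 * P * (pi + 48 * pi / d\<^sup>2)) *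
       integral {-(pi/2)..pi/2} (\<lambda>t. (cmod (exp_sum K c l t))\<^sup>2)"
proof -
  let ?I = "{-(pi/2)..pi/2}"
  define B where "B = (1 + 8 * (real P)\<^sup>2 / d\<^sup>2) ^ P"
  define C where "C = pi + 48 * pi / d\<^sup>2"
  define J where "J = cmod (cos_ft P 0)"
  have J: "J > 0" "cos_ft P 0 = of_real J" using cos_ft_0_pos[of P] by (auto simp: J_def)
  define S where "S = (\<lambda>k. {j \<in> K - {k}. \<bar>l j - l k\<bar> \<le> 4 * real P})"
  have finS: "finite (S k)" for k using K by (simp add: S_def)
  have S_sep: "d \<le> \<bar>l j - l k\<bar>" if "j \<in> S k" "k \<in> K" for j k
    using that K(3)[of j k] by (auto simp: S_def)
  have S_sep': "d \<le> \<bar>(l i - l k) - (l j - l k)\<bar>" if "i \<in> S k" "j \<in> S k" "i \<noteq> j" for i j k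
    using that K(3)[of i j] by (auto simp: S_def)
  define p where "p = (\<lambda>k z. complex_of_real (\<Prod>i\<in>S k. 1 - z\<^sup>2 / (l i - l k)\<^sup>2))"
  have cS: "card (S k) \<le> N" if "k \<in> K" for k using count[OF that] by (simp add: S_def)
  have "\<exists>a :: nat \<Rightarrow> real. (\<forall>z. p k z * cos_ft P z = (\<Sum>q\<le>P. of_real (a q) * cos_ft q z)) \<and>
            (\<Sum>q\<le>P. \<bar>a q\<bar>) \<le> B \<and> a 0 = 0" if k: "k \<in> K" for k
  proof -
    have "\<exists>a :: nat \<Rightarrow> real. (\<forall>z. p k z * cos_ft P z = (\<Sum>q\<le>P. of_real (a q) * cos_ft q z)) \<and>
            (\<Sum>q\<le>P. \<bar>a q\<bar>) \<le> (1 + 8 * (real P)\<^sup>2 / d\<^sup>2) ^ card (S k) \<and> a 0 = 0"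
      unfolding p_def using cS[OF k] P(1) S_sep k
      by (intro cos_ft_multiplier finS K(2)) auto
    moreover have "(1 + 8 * (real P)\<^sup>2 / d\<^sup>2) ^ card (S k) \<le> B"
      unfolding B_def using cS[OF k] P(1) by (intro power_increasing) auto
    ultimately show ?thesis by (meson order_trans)
  qed
  then obtain a :: "_ \<Rightarrow> nat \<Rightarrow> real" where a: "\<And>k z. k \<in> K
      \<Longrightarrow> p k z * cos_ft P z = (\<Sum>q\<le>P. of_real (a k q) * cos_ft q z)"
    "\<And>k. k \<in> K \<Longrightarrow> (\<Sum>q\<le>P. \<bar>a k q\<bar>) \<le> B" "\<And>k. k \<in> K \<Longrightarrow> a k 0 = 0"
    by metis
  define F where "F = exp_sum K c l"
  have contF: "continuous_on ?I F" unfolding F_def by (intro continuous_intros)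
  define b where "b = (\<lambda>q k. integral ?I (\<lambda>t. F t * (of_real (cos t ^ (2 * q)) * cis (- l k * t))))"
  have b: "b q k = (\<Sum>j\<in>K. c j * cos_ft q (l j - l k))" for q k
  proof -
    have "((\<lambda>t. \<Sum>j\<in>K. c j * (of_real (cos t ^ (2 * q)) * cis ((l j - l k) * t)))
        has_integral (\<Sum>j\<in>K. c j * cos_ft q (l j - l k))) ?I"
      by (intro has_integral_sum K has_integral_mult_right cos_ft_has_integral)
    moreover have "(\<Sum>j\<in>K. c j * (of_real (cos t ^ (2 * q)) * cis ((l j - l k) * t)))
        = F t * (of_real (cos t ^ (2 * q)) * cis (- l k * t))" for t
    proof -
      have "cis ((l j - l k) * t) = cis (l j * t) * cis (- l k * t)" for j
        by (simp add: cis_mult algebra_simps)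
      then show ?thesis by (simp add: F_def sum_distrib_left sum_distrib_right mult_ac)
    qed
    ultimately show ?thesis by (simp add: b_def integral_unique)
  qed
  define \<alpha> where "\<alpha> = (\<lambda>k. \<Sum>q\<le>P. of_real (a k q) * b q k)"
  define s where "s = (\<Sum>k\<in>K. (cmod (c k))\<^sup>2)"
  have \<alpha>_bound: "(\<Sum>k\<in>K. (cmod (\<alpha> k))\<^sup>2) \<le> B\<^sup>2 * P * C * integral ?I (\<lambda>t. (cmod (F t))\<^sup>2)"
  proof -
    have "(cmod (\<alpha> k))\<^sup>2 \<le> B\<^sup>2 * (\<Sum>q=1..P. (cmod (b q k))\<^sup>2)" if k: "k \<in> K" for k
    proof -
      define \<beta> where "\<beta> = sqrt (\<Sum>q=1..P. (cmod (b q k))\<^sup>2)"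
      have \<beta>: "\<beta> \<ge> 0" "\<beta>\<^sup>2 = (\<Sum>q=1..P. (cmod (b q k))\<^sup>2)" by (auto simp: \<beta>_def sum_nonneg)
      have "cmod (\<alpha> k) \<le> (\<Sum>q\<le>P. \<bar>a k q\<bar> * \<beta>)"
        unfolding \<alpha>_def
      proof (intro sum_norm_le)
        fix q assume q: "q \<in> {..P}"
        show "cmod (of_real (a k q) * b q k) \<le> \<bar>a k q\<bar> * \<beta>"
        proof (cases "q = 0")
          case False
          have "(cmod (b q k))\<^sup>2 \<le> (\<Sum>q=1..P. (cmod (b q k))\<^sup>2)"
            using q False by (intro member_le_sum) auto
          then have "cmod (b q k) \<le> \<beta>" unfolding \<beta>_def by (rule real_le_rsqrt)
          then show ?thesis by (auto simp: norm_mult intro: mult_left_mono)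
        qed (use a(3)[OF k] in simp)
      qed
      also have "\<dots> = (\<Sum>q\<le>P. \<bar>a k q\<bar>) * \<beta>" by (simp add: sum_distrib_right)
      also have "\<dots> \<le> B * \<beta>" using a(2)[OF k] \<beta> by (intro mult_right_mono)
      finally have "(cmod (\<alpha> k))\<^sup>2 \<le> (B * \<beta>)\<^sup>2" by (intro power_mono) auto
      then show ?thesis by (simp add: power_mult_distrib \<beta>)
    qed
    then have "(\<Sum>k\<in>K. (cmod (\<alpha> k))\<^sup>2) \<le> (\<Sum>k\<in>K. B\<^sup>2 * (\<Sum>q=1..P. (cmod (b q k))\<^sup>2))"
      by (rule sum_mono)
    also have "\<dots> = B\<^sup>2 * (\<Sum>q=1..P. \<Sum>k\<in>K. (cmod (b q k))\<^sup>2)"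
      by (subst sum.swap) (simp add: sum_distrib_left)
    also have "\<dots> \<le> B\<^sup>2 * (\<Sum>q=1..P. C * integral ?I (\<lambda>t. (cmod (F t))\<^sup>2))"
      unfolding b_def C_def
      by (intro mult_left_mono sum_mono sum_norm_square_cos_coeff_le K contF) auto
    also have "\<dots> = B\<^sup>2 * P * C * integral ?I (\<lambda>t. (cmod (F t))\<^sup>2)" by simp
    finally show ?thesis .
  qed
  define M where "M = (\<lambda>k j. p k (l j - l k) * cos_ft P (l j - l k))"
  define m where "m = (\<lambda>k j. if k = j then 0 else 16 * (real P)\<^sup>2 * (1/2) ^ P / (l k - l j)\<^sup>2 * J)"
  have M0: "M k k = of_real J" for k
    using J by (simp add: M_def p_def)
  have M_le: "cmod (M k j) \<le> m k j" if kj: "k \<in> K" "j \<in> K" "j \<noteq> k" for k j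
  proof (cases "j \<in> S k")
    case True
    have "(l j - l k)\<^sup>2 \<noteq> 0" using S_sep[OF True kj(1)] K(2) by auto
    then have "p k (l j - l k) = 0" using True finS[of k] by (auto simp: p_def intro!: bexI[of _ j])
    then show ?thesis using kj J by (simp add: M_def m_def)
  next
    case False
    then have w: "4 * real P < \<bar>l j - l k\<bar>" using kj by (auto simp: S_def)
    have "cmod (M k j) \<le> 16 * (real P)\<^sup>2 * (1/2) ^ P / (l j - l k)\<^sup>2 * cmod (cos_ft P 0)"
      unfolding M_def p_def
    proof (rule norm_near_multiplier_le[OF finS K(2) S_sep[OF _ kj(1)] S_sep' _ _ P(2)[OF cS[OF
        kj(1)]] w])
      show "card (S k) < P" using cS[OF kj(1)] P(1) by simp
    qed (auto simp: S_def)
    then show ?thesis using kj by (simp add: m_def J_def power2_commute)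
  qed
  have \<alpha>: "\<alpha> k = (\<Sum>j\<in>K. c j * M k j)" if k: "k \<in> K" for k
  proof -
    have "\<alpha> k = (\<Sum>j\<in>K. c j * (\<Sum>q\<le>P. of_real (a k q) * cos_ft q (l j - l k)))"
      unfolding \<alpha>_def b sum_distrib_left by (subst sum.swap) (simp add: mult_ac)
    then show ?thesis by (simp only: M_def a(1)[OF k])
  qed
  have "J * s = cmod (of_real (J * s))" unfolding norm_of_real using J
    by (simp add: s_def sum_nonneg)
  also have "complex_of_real (J * s)
      = (\<Sum>k\<in>K. cnj (c k) * \<alpha> k) - (\<Sum>k\<in>K. \<Sum>j\<in>K - {k}. cnj (c k) * c j * M k j)"
  proof -
    have "cnj (c k) * \<alpha> k = of_real J * of_real ((cmod (c k))\<^sup>2) + (\<Sum>j\<in>K - {k}. cnj (c k) * c j *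
        M k j)" if k: "k \<in> K" for k
    proof -
      have "\<alpha> k = c k * M k k + (\<Sum>j\<in>K - {k}. c j * M k j)"
        unfolding \<alpha>[OF k] by (rule sum.remove[OF K(1) k])
      then show ?thesis
        unfolding complex_norm_square by (simp add: M0 distrib_left sum_distrib_left mult_ac)
    qed
    then show ?thesis by (simp add: sum.distrib s_def sum_distrib_left)
  qed
  also have "cmod \<dots> \<le> cmod (\<Sum>k\<in>K. cnj (c k) * \<alpha> k) + cmod (\<Sum>k\<in>K. \<Sum>j\<in>K - {k}. cnj (c k) * c j *
      M k j)"
    by (rule norm_triangle_ineq4)
  also have "cmod (\<Sum>k\<in>K. cnj (c k) * \<alpha> k) \<le> (\<Sum>k\<in>K. J / 4 * (cmod (c k))\<^sup>2 + 1 / J * (cmod (\<alpha> k))\<^sup>2)"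
  proof (intro sum_norm_le)
    fix k
    have "0 \<le> (J / 2 * cmod (c k) - cmod (\<alpha> k))\<^sup>2" by simp
    then have "J * (cmod (c k) * cmod (\<alpha> k)) \<le> J\<^sup>2 / 4 * (cmod (c k))\<^sup>2 + (cmod (\<alpha> k))\<^sup>2"
      by (simp add: power2_diff power_mult_distrib power_divide)
    then have "J * (cmod (c k) * cmod (\<alpha> k)) / J \<le> (J\<^sup>2 / 4 * (cmod (c k))\<^sup>2 + (cmod (\<alpha> k))\<^sup>2) / J"
      using J by (intro divide_right_mono) auto
    then show "cmod (cnj (c k) * \<alpha> k) \<le> J / 4 * (cmod (c k))\<^sup>2 + 1 / J * (cmod (\<alpha> k))\<^sup>2"
      using J by (simp add: norm_mult add_divide_distrib power2_eq_square)
  qed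
  also have "(\<Sum>k\<in>K. J / 4 * (cmod (c k))\<^sup>2 + 1 / J * (cmod (\<alpha> k))\<^sup>2)
      = J / 4 * s + 1 / J * (\<Sum>k\<in>K. (cmod (\<alpha> k))\<^sup>2)"
    by (simp add: s_def sum.distrib sum_distrib_left)
  also have "cmod (\<Sum>k\<in>K. \<Sum>j\<in>K - {k}. cnj (c k) * c j * M k j)
      \<le> (\<Sum>k\<in>K. \<Sum>j\<in>K - {k}. cmod (c k) * cmod (c j) * m k j)"
    by (intro sum_norm_le) (auto simp: norm_mult intro!: mult_left_mono M_le)
  also have "\<dots> \<le> (\<Sum>k\<in>K. \<Sum>j\<in>K. cmod (c k) * cmod (c j) * m k j)"
    using K(1) J by (intro sum_mono sum_mono2) (auto simp: m_def)
  also have "\<dots> \<le> J / 2 * s"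
    unfolding s_def
  proof (rule symmetric_bilinear_le)
    fix k assume k: "k \<in> K"
    have "(\<Sum>j\<in>K. m k j) = (\<Sum>j\<in>K - {k}. m k j)"
      by (rule sum.mono_neutral_right) (use K in \<open>auto simp: m_def\<close>)
    also have "\<dots> = 16 * (real P)\<^sup>2 * (1/2) ^ P * J * (\<Sum>j\<in>K - {k}. 1 / (l k - l j)\<^sup>2)"
      unfolding sum_distrib_left by (intro sum.cong) (auto simp: m_def)
    also have "\<dots> \<le> 16 * (real P)\<^sup>2 * (1/2) ^ P * J * (8 / d\<^sup>2)"
    proof (intro mult_left_mono separated_sum_inverse_squares_le)
      show "d \<le> \<bar>l k - l i\<bar>" if "i \<in> K - {k}" for i using that K(3)[of k i] k by auto
      show "d \<le> \<bar>(l k - l i) - (l k - l j)\<bar>" if "i \<in> K - {k}" "j \<in> K - {k}" "i \<noteq> j" for i j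
        using that K(3)[of i j] by auto
    qed (use K J in auto)
    also have "\<dots> \<le> J * (1/2)"
      using mult_left_mono[OF P(3), of J] J by (simp add: mult_ac)
    finally show "(\<Sum>j\<in>K. m k j) \<le> J / 2" by simp
  qed (use J in \<open>auto simp: m_def power2_commute\<close>)
  finally have "J * s \<le> J / 4 * s + 1 / J * (\<Sum>k\<in>K. (cmod (\<alpha> k))\<^sup>2) + J / 2 * s" by simp
  then have "J / 4 * s \<le> 1 / J * (\<Sum>k\<in>K. (cmod (\<alpha> k))\<^sup>2)" by linarith
  also have "\<dots> \<le> 1 / J * (B\<^sup>2 * P * C * integral ?I (\<lambda>t. (cmod (F t))\<^sup>2))"
    using \<alpha>_bound J by (intro mult_left_mono) auto
  finally have *: "J / 4 * s \<le> 1 / J * (B\<^sup>2 * P * C * integral ?I (\<lambda>t. (cmod (F t))\<^sup>2))" .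
  define X where "X = integral ?I (\<lambda>t. (cmod (F t))\<^sup>2)"
  have "s = 4 / J * (J / 4 * s)" using J by simp
  also have "\<dots> \<le> 4 / J * (1 / J * (B\<^sup>2 * P * C * X))"
    using J * by (intro mult_left_mono) (auto simp: X_def)
  also have "\<dots> = (4 / J\<^sup>2 * B\<^sup>2 * P * C) * X" by (simp add: power2_eq_square)
  finally show ?thesis unfolding s_def B_def C_def X_def F_def J_def .
qed

lemma power_over_fact_le_exp:
  fixes x :: real
  assumes "x \<ge> 0" shows "x ^ n / fact n \<le> exp x"
proof -
  have "(\<Sum>k\<in>{n}. x ^ k /\<^sub>R fact k) \<le> (\<Sum>k. x ^ k /\<^sub>R fact k)"
    using assms by (intro sum_le_suminf summable_exp_generic) (auto intro: scaleR_nonneg_nonneg)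
  then show ?thesis by (simp add: exp_def divide_inverse mult.commute)
qed

lemma exp_sum_parameters_exist:
  assumes "d > (0::real)"
  shows "\<exists>\<eta>>0. \<eta> < 1 \<and> (\<exists>P0. \<forall>P\<ge>P0. (\<forall>n. real n \<le> \<eta> * real P \<longrightarrow> ((8 * real P / d) ^ n / fact n)\<^sup>2
      \<le> (3/2) ^ P) \<and>
           16 * (real P)\<^sup>2 * (1/2) ^ P * (8 / d\<^sup>2) \<le> 1/2)"
proof -
  define L where "L = max 1 (ln (128 / d))"
  define \<eta> where "\<eta> = 1 / (16 * L)"
  have L: "L \<ge> 1" "ln (128 / d) \<le> L" by (auto simp: L_def)
  have \<eta>: "\<eta> > 0" "\<eta> < 1" using L by (auto simp: \<eta>_def)
  have e4: "exp (1/4) \<le> (3/2::real)"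
  proof (rule power_le_imp_le_base)
    have "exp (1/4) ^ Suc 3 = exp (1::real)" by (simp flip: exp_of_nat_mult)
    also have "\<dots> \<le> 3" by (rule exp_le)
    also have "\<dots> \<le> (3/2) ^ Suc 3" by (simp add: power_divide)
    finally show "exp (1/4) ^ Suc 3 \<le> (3/2::real) ^ Suc 3" .
  qed simp
  have 1: "((8 * real P / d) ^ n / fact n)\<^sup>2 \<le> (3/2) ^ P" if n: "real n \<le> \<eta> * real P" for P n
  proof -
    have "(8 * real P / d) ^ n / fact n = (128 / d) ^ n * ((real P / 16) ^ n / fact n)"
      by (simp flip: power_mult_distrib)
    also have "\<dots> \<le> exp (real n * ln (128 / d)) * exp (real P / 16)"
      using assms by (intro mult_mono power_over_fact_le_exp) (auto simp: exp_of_nat_mult)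
    also have "real n * ln (128 / d) \<le> \<eta> * real P * L"
      using n L \<eta> by (intro order_trans[OF mult_left_mono[OF L(2)] mult_right_mono]) auto
    also have "\<eta> * real P * L = real P / 16" using L by (simp add: \<eta>_def)
    finally have "(8 * real P / d) ^ n / fact n \<le> exp (real P / 16) * exp (real P / 16)" by simp
    then have "((8 * real P / d) ^ n / fact n)\<^sup>2 \<le> (exp (real P / 16) * exp (real P / 16))\<^sup>2"
      using assms by (intro power_mono) auto
    also have "\<dots> = exp (real P * (1/4))" by (simp add: power2_eq_square flip: exp_add)
    also have "\<dots> = exp (1/4) ^ P" by (rule exp_of_nat_mult)
    also have "exp (1/4) ^ P \<le> (3/2::real) ^ P" by (intro power_mono e4) auto
    finally show ?thesis .
  qed
  have "((\<lambda>P. 16 * (real P)\<^sup>2 * (1/2) ^ P * (8 / d\<^sup>2)) \<longlongrightarrow> 0) sequentially"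
    by real_asymp
  then have "\<forall>\<^sub>F P in sequentially. 16 * (real P)\<^sup>2 * (1/2) ^ P * (8 / d\<^sup>2) < 1/2"
    by (rule order_tendstoD) simp
  then obtain P0 where "\<And>P. P \<ge> P0 \<Longrightarrow> 16 * (real P)\<^sup>2 * (1/2) ^ P * (8 / d\<^sup>2) < 1/2"
    by (auto simp: eventually_sequentially)
  then show ?thesis using 1 \<eta> by (meson less_imp_le)
qed

theorem exp_sum_lower_bound:
  fixes l :: "nat \<Rightarrow> real"
  assumes d: "d > 0" "\<And>i j. i \<noteq> j \<Longrightarrow> d \<le> \<bar>l i - l j\<bar>"
    and density: "\<And>\<eta>. \<eta> > 0 \<Longrightarrow> \<exists>r0. \<forall>r\<ge>r0. \<forall>a. finite {k. l k \<in> {a..a + r}}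
        \<and> real (card {k. l k \<in> {a..a + r}}) \<le> \<eta> * r"
    and s0: "s0 > 0"
  shows "\<exists>C>0. \<forall>s\<ge>s0. \<forall>K c. finite K \<longrightarrow> (\<Sum>k\<in>K. (cmod (c k))\<^sup>2)
    \<le> C * integral {-(pi/2)..pi/2} (\<lambda>t. (cmod (\<Sum>k\<in>K. c k * cis (s * l k * t)))\<^sup>2)"
proof -
  define d' where "d' = s0 * d"
  have d': "d' > 0" using d s0 by (simp add: d'_def)
  obtain \<eta> P0 where \<eta>: "\<eta> > 0" "\<eta> < 1"
    and P0: "\<And>P n. P \<ge> P0 \<Longrightarrow> real n \<le> \<eta> * real P \<Longrightarrow> ((8 * real P / d') ^ n / fact n)\<^sup>2 \<le> (3/2) ^ P"
      "\<And>P. P \<ge> P0 \<Longrightarrow> 16 * (real P)\<^sup>2 * (1/2) ^ P * (8 / d'\<^sup>2) \<le> 1/2"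
    using exp_sum_parameters_exist[OF d'] by blast
  obtain r0 where r0: "\<And>r a. r \<ge> r0 \<Longrightarrow> finite {k. l k \<in> {a..a + r}}
      \<and> real (card {k. l k \<in> {a..a + r}}) \<le> \<eta> * s0 / 8 * r"
    using density[of "\<eta> * s0 / 8"] \<eta> s0 by auto
  define P where "P = max (max 1 P0) (nat \<lceil>s0 * r0 / 8\<rceil>)"
  have P: "P \<ge> 1" "P \<ge> P0" and "s0 * r0 / 8 \<le> real P"
    by (auto simp: P_def) linarith
  then have r0_le: "r0 \<le> 8 * real P / s0" using s0 by (simp add: field_simps)
  define N where "N = nat \<lfloor>\<eta> * real P\<rfloor>"
  have N: "real n \<le> \<eta> * real P \<longleftrightarrow> n \<le> N" for n
    using \<eta> by (simp add: N_def le_nat_iff le_floor_iff)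
  have "real N \<le> \<eta> * real P" using N by blast
  also have "\<dots> < 1 * real P" using \<eta> P by (intro mult_strict_right_mono) auto
  finally have NP: "N < P" by simp
  define C where "C = 4 / (cmod (cos_ft P 0))\<^sup>2 * ((1 + 8 * (real P)\<^sup>2 / d'\<^sup>2) ^ P)\<^sup>2 * P * (pi +
      48 * pi / d'\<^sup>2)"
  have "C > 0"
  proof -
    have "cos_ft P 0 \<noteq> 0" using cos_ft_0_pos[of P] by auto
    moreover have "1 + 8 * (real P)\<^sup>2 / d'\<^sup>2 > 0" "pi + 48 * pi / d'\<^sup>2 > 0" using d'
      by (simp_all add: add_pos_nonneg)
    ultimately show ?thesis using P unfolding C_def
      by (intro mult_pos_pos divide_pos_pos zero_less_power) auto
  qed
  moreover have "(\<Sum>k\<in>K. (cmod (c k))\<^sup>2)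
      \<le> C * integral {-(pi/2)..pi/2} (\<lambda>t. (cmod (\<Sum>k\<in>K. c k * cis (s * l k *
          t)))\<^sup>2)" if s: "s \<ge> s0" and K: "finite K" for s K c
    unfolding C_def
  proof (rule exp_sum_lower_bound_aux[where l = "\<lambda>k. s * l k" and N = N, OF K d'])
    fix i j assume "i \<in> K" "j \<in> K" "i \<noteq> j"
    have "s0 * d \<le> s * \<bar>l i - l j\<bar>" using s s0 d(1) d(2)[OF \<open>i \<noteq> j\<close>] by (intro mult_mono) auto
    also have "\<dots> = \<bar>s * l i - s * l j\<bar>" using s s0 by (simp add: abs_mult flip: right_diff_distrib)
    finally show "d' \<le> \<bar>s * l i - s * l j\<bar>" by (simp add: d'_def)
  next
    fix k assume "k \<in> K"
    define r where "r = 8 * real P / s0"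
    define A where "A = {j. l j \<in> {l k - r / 2..l k - r / 2 + r}}"
    have A: "finite A" "real (card A) \<le> \<eta> * s0 / 8 * r" using r0[OF r0_le, of "l k - r / 2"]
      by (auto simp: A_def r_def)
    have "{j \<in> K - {k}. \<bar>s * l j - s * l k\<bar> \<le> 4 * real P} \<subseteq> A"
    proof (rule subsetI)
      fix j assume "j \<in> {j \<in> K - {k}. \<bar>s * l j - s * l k\<bar> \<le> 4 * real P}"
      then have "\<bar>s * l j - s * l k\<bar> \<le> 4 * real P" by simp
      then have "s * \<bar>l j - l k\<bar> \<le> 4 * real P" using s s0
        by (simp add: abs_mult flip: right_diff_distrib)
      moreover have "s0 * \<bar>l j - l k\<bar> \<le> s * \<bar>l j - l k\<bar>" using s by (intro mult_right_mono) auto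
      ultimately have "\<bar>l j - l k\<bar> \<le> r / 2" using s0 by (simp add: r_def field_simps)
      then have "l j - l k \<le> r / 2" "- (l j - l k) \<le> r / 2" unfolding abs_le_iff by auto
      then show "j \<in> A" by (simp add: A_def)
    qed
    then have "real (card {j \<in> K - {k}. \<bar>s * l j - s * l k\<bar> \<le> 4 * real P}) \<le> real (card A)"
      using A by (simp add: card_mono)
    also have "\<dots> \<le> \<eta> * real P" using A(2) s0 by (simp add: r_def)
    finally show "card {j \<in> K - {k}. \<bar>s * l j - s * l k\<bar> \<le> 4 * real P} \<le> N" by (simp only: N)
  next
    show "N < P" by (rule NP)
    show "((8 * real P / d') ^ n / fact n)\<^sup>2 \<le> (3/2) ^ P" if "n \<le> N" for n
      using P0(1)[OF P(2)] that N by simp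
    show "16 * (real P)\<^sup>2 * (1/2) ^ P * (8 / d'\<^sup>2) \<le> 1/2" by (rule P0(2)[OF P(2)])
  qed
  ultimately show ?thesis by blast
qed

subsection \<open>Positive definite functions as limits of Fourier transforms\<close>

definition gauss :: "'a::euclidean_space \<Rightarrow> real" where
  "gauss x = exp (- (norm x)\<^sup>2 / 2)"

lemma gauss_pos: "gauss x > 0"
  by (simp add: gauss_def)

lemma gauss_nonneg [simp]: "0 \<le> gauss x" and abs_gauss [simp]: "\<bar>gauss x\<bar> = gauss x"
  by (simp_all add: gauss_def)

lemma gauss_minus: "gauss (- x) = gauss x"
  by (simp add: gauss_def)

lemma continuous_on_gauss [continuous_intros]: "continuous_on S f
    \<Longrightarrow> continuous_on S (\<lambda>x. gauss (f x))"
  unfolding gauss_def by (intro continuous_intros) auto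

lemma borel_measurable_gauss [measurable]: "gauss \<in> borel_measurable borel"
  by (intro borel_measurable_continuous_onI continuous_intros)

lemma gauss_Pair: "gauss (x, y) = gauss x * gauss y"
  by (simp add: gauss_def norm_Pair add_divide_distrib flip: exp_add)

lemma gauss_le_1: "gauss x \<le> 1"
  by (simp add: gauss_def)

lemma real_gauss_eq: "exp (- t\<^sup>2 / 2) = sqrt (2 * pi) * std_normal_density t"
  by (simp add: std_normal_density_def)

lemma integrable_real_gauss: "integrable lborel (\<lambda>t::real. exp (- t\<^sup>2 / 2))"
  unfolding real_gauss_eq by (intro integrable_mult_right integrable_normal_density) auto

lemma integral_real_gauss_cis:
  "integrable lborel (\<lambda>t. complex_of_real (exp (- t\<^sup>2 / 2)) * cis (t * y))" (is ?I)
  "(\<integral>t. complex_of_real (exp (- t\<^sup>2 / 2)) * cis (t * y) \<partial>lborel)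
      = of_real (sqrt (2 * pi) * exp (- y\<^sup>2 / 2))" (is ?E)
proof -
  show ?I
    by (rule Bochner_Integration.integrable_bound[OF integrable_real_gauss])
       (auto simp: norm_mult intro!: borel_measurable_continuous_onI continuous_intros)
  have "complex_of_real (exp (- y\<^sup>2 / 2)) = char std_normal_distribution y"
    by (simp add: char_std_normal_distribution)
  also have "\<dots> = (\<integral>t. std_normal_density t *\<^sub>R cis (t * y) \<partial>lborel)"
    unfolding char_def by (subst integral_density) (auto simp: cis_conv_exp mult.commute)
  finally have "of_real (sqrt (2 * pi)) * complex_of_real (exp (- y\<^sup>2 / 2))
      = of_real (sqrt (2 * pi)) * (\<integral>t. std_normal_density t *\<^sub>R cis (t * y) \<partial>lborel)" by simp
  also have "\<dots> = (\<integral>t. of_real (sqrt (2 * pi)) * (std_normal_density t *\<^sub>R cis (t * y)) \<partial>lborel)"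
    by (rule integral_mult_right_zero[symmetric])
  also have "\<dots> = (\<integral>t. complex_of_real (exp (- t\<^sup>2 / 2)) * cis (t * y) \<partial>lborel)"
    unfolding real_gauss_eq by (simp add: scaleR_conv_of_real mult.assoc)
  finally show ?E by simp
qed

lemma gauss_cis_eq_prod:
  "complex_of_real (gauss v) * cis (v \<bullet> x)
      = (\<Prod>b\<in>Basis. complex_of_real (exp (- (v \<bullet> b)\<^sup>2 / 2)) * cis ((v \<bullet> b) * (x \<bullet> b)))"
proof -
  have "gauss v = (\<Prod>b\<in>Basis. exp (- (v \<bullet> b)\<^sup>2 / 2))"
    unfolding gauss_def power2_norm_eq_inner euclidean_inner[of v v]
    by (simp add: sum_negf sum_divide_distrib power2_eq_square flip: exp_sum)
  moreover have "cis (v \<bullet> x) = (\<Prod>b\<in>Basis. cis ((v \<bullet> b) * (x \<bullet> b)))"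
    unfolding euclidean_inner[of v x] cis_conv_exp
    by (simp add: sum_distrib_left exp_sum)
  ultimately show ?thesis by (simp add: prod.distrib)
qed

lemma
  fixes x :: "'a::euclidean_space"
  shows integrable_gauss_cis: "integrable lborel (\<lambda>v. complex_of_real (gauss v) *
      cis (v \<bullet> x))" (is ?I)
    and integral_gauss_cis: "(\<integral>v. complex_of_real (gauss v) * cis (v \<bullet> x) \<partial>lborel)
        = of_real (sqrt (2 * pi) ^ DIM('a) * gauss x)" (is ?E)
proof -
  interpret product_sigma_finite "\<lambda>_::'a. lborel :: real measure" ..
  define h where "h = (\<lambda>b t. complex_of_real (exp (- t\<^sup>2 / 2)) * cis (t * (x \<bullet> b)))"
  have h: "integrable lborel (h b)" "integral\<^sup>L lborel (h b)
      = of_real (sqrt (2 * pi) * exp (- (x \<bullet> b)\<^sup>2 / 2))" for b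
    unfolding h_def by (rule integral_real_gauss_cis)+
  let ?T = "\<lambda>f. \<Sum>b\<in>Basis. f b *\<^sub>R (b :: 'a)"
  have meas: "(\<lambda>v. complex_of_real (gauss v) * cis (v \<bullet> x)) \<in> borel_measurable borel"
    by (intro borel_measurable_continuous_onI continuous_intros)
  have T: "?T \<in> (\<Pi>\<^sub>M b\<in>Basis. lborel) \<rightarrow>\<^sub>M borel" by measurable
  have eq: "complex_of_real (gauss (?T f)) * cis (?T f \<bullet> x) = (\<Prod>b\<in>Basis. h b (f b))" for f
    unfolding gauss_cis_eq_prod h_def
    by (intro prod.cong refl) (simp add: inner_sum_left inner_Basis if_distrib cong: if_cong)
  have "integrable (distr (\<Pi>\<^sub>M b\<in>Basis. lborel) borel ?T) (\<lambda>v. complex_of_real (gauss v) *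
      cis (v \<bullet> x))"
    by (subst integrable_distr_eq[OF T meas]) (simp only: eq product_integrable_prod[OF finite_Basis
        h(1)])
  then show ?I by (simp only: lborel_eq[symmetric])
  have "(\<integral>v. complex_of_real (gauss v) * cis (v \<bullet> x) \<partial>lborel)
      = (\<integral>f. (\<Prod>b\<in>Basis. h b (f b)) \<partial>(\<Pi>\<^sub>M b\<in>Basis. lborel))"
    by (subst lborel_eq, subst integral_distr[OF T meas]) (simp only: eq)
  also have "\<dots> = (\<Prod>b\<in>Basis. of_real (sqrt (2 * pi) * exp (- (x \<bullet> b)\<^sup>2 / 2)))"
    by (subst product_integral_prod[OF finite_Basis h(1)]) (simp only: h(2))
  also have "\<dots> = of_real (sqrt (2 * pi) ^ DIM('a)) * (\<Prod>b\<in>Basis. of_real (exp (- (x \<bullet> b)\<^sup>2 / 2)) *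
      cis ((x \<bullet> b) * (0 \<bullet> b)))"
    by (simp add: prod.distrib)
  also have "\<dots> = of_real (sqrt (2 * pi) ^ DIM('a) * gauss x)"
    by (subst gauss_cis_eq_prod[symmetric]) simp
  finally show ?E .
qed

lemma integrable_gauss: "integrable lborel (gauss :: 'a::euclidean_space \<Rightarrow> real)"
proof -
  have "integrable lborel (\<lambda>v::'a. norm (complex_of_real (gauss v) * cis (v \<bullet> 0)))"
    by (intro integrable_norm integrable_gauss_cis)
  then show ?thesis by (simp add: gauss_pos less_imp_le abs_of_pos)
qed

lemma integral_gauss_pos: "integral\<^sup>L lborel (gauss :: 'a::euclidean_space \<Rightarrow> real) > 0"
proof -
  have "complex_of_real (integral\<^sup>L lborel (gauss :: 'a \<Rightarrow> real))
      = (\<integral>v. complex_of_real (gauss v) * cis (v \<bullet> (0::'a)) \<partial>lborel)"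
    by simp
  also have "\<dots> = of_real (sqrt (2 * pi) ^ DIM('a))" 
    by (subst integral_gauss_cis) (simp add: gauss_def)
  finally show ?thesis by (simp only: of_real_eq_iff) simp
qed

lemma integrable_gauss_bounded:
  fixes h :: "'a::euclidean_space \<Rightarrow> complex"
  assumes [measurable]: "h \<in> borel_measurable borel" and "\<And>x. norm (h x) \<le> B"
  shows "integrable lborel (\<lambda>x. of_real (gauss x) * h x)"
proof (rule Bochner_Integration.integrable_bound)
  show "integrable lborel (\<lambda>x::'a. gauss x * B)" by (intro integrable_mult_left integrable_gauss)
  show "AE x in lborel. norm (of_real (gauss x) * h x) \<le> norm (gauss x * B)"
    using assms(2) gauss_pos by (intro AE_I2) (auto simp: norm_mult abs_mult intro!: mult_left_mono
        order_trans[OF assms(2)])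
qed simp

lemma lborel_integral_affine:
  fixes f :: "'a::euclidean_space \<Rightarrow> complex"
  assumes [measurable]: "f \<in> borel_measurable borel" and c: "c \<noteq> 0"
  shows "(\<integral>x. f x \<partial>lborel) = of_real (\<bar>c\<bar> ^ DIM('a)) * (\<integral>x. f (t + c *\<^sub>R x) \<partial>lborel)"
proof -
  have "(\<integral>x. f x \<partial>lborel) = (\<integral>x. f x \<partial>density (distr lborel borel (\<lambda>x. t +
      c *\<^sub>R x)) (\<lambda>_. ennreal (\<bar>c\<bar>^DIM('a))))"
    using lborel_affine[OF c, of t] by (simp add: ennreal_power)
  also have "\<dots> = (\<integral>x. (\<bar>c\<bar>^DIM('a)) *\<^sub>R f (t + c *\<^sub>R x) \<partial>lborel)"
    by (subst integral_density) (auto simp: integral_distr)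
  finally show ?thesis by (simp add: scaleR_conv_of_real)
qed

lemma (in prob_space) distr_PiM_pair:
  assumes "finite I" "i \<in> I" "j \<in> I" "i \<noteq> j"
  shows "distr (\<Pi>\<^sub>M k\<in>I. M) (M \<Otimes>\<^sub>M M) (\<lambda>\<omega>. (\<omega> i, \<omega> j)) = M \<Otimes>\<^sub>M M"
proof (rule pair_measure_eqI[symmetric])
  interpret P: product_prob_space "\<lambda>_. M" I ..
  show "sigma_finite_measure M" ..
  show "sigma_finite_measure M" ..
  fix A B assume [measurable]: "A \<in> sets M" "B \<in> sets M"
  have "emeasure (distr (\<Pi>\<^sub>M k\<in>I. M) (M \<Otimes>\<^sub>M M) (\<lambda>\<omega>. (\<omega> i, \<omega> j))) (A \<times> B)
     = emeasure (\<Pi>\<^sub>M k\<in>I. M) {\<omega>\<in>space (\<Pi>\<^sub>M k\<in>I. M). \<forall>k\<in>{i, j}. \<omega> k \<in> (if k = i then A else B)}"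
    using assms by (subst emeasure_distr) (auto intro!: arg_cong2[where f=emeasure])
  also have "\<dots> = emeasure M A * emeasure M B"
    using assms by (subst P.emeasure_PiM_Collect) auto
  finally show "emeasure M A * emeasure M B
      = emeasure (distr (\<Pi>\<^sub>M k\<in>I. M) (M \<Otimes>\<^sub>M M) (\<lambda>\<omega>. (\<omega> i, \<omega> j))) (A \<times> B)" by simp
qed simp

lemma complex_integral_nonneg:
  fixes f :: "'a \<Rightarrow> complex"
  assumes "integrable M f" "\<And>x. 0 \<le> f x"
  shows "0 \<le> integral\<^sup>L M f"
proof -
  have "Re (integral\<^sup>L M f) = (\<integral>x. Re (f x) \<partial>M)" "Im (integral\<^sup>L M f) = (\<integral>x. Im (f x) \<partial>M)"
    using assms(1) by simp_all
  then show ?thesis using assms(2) by (simp add: less_eq_complex_def)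
qed

text \<open>Average the positive quadratic form over \<open>m\<close> independent random points and let \<open>m\<close> grow:
  the \<open>m\<close> diagonal terms are negligible against the \<open>m (m - 1)\<close> off-diagonal ones.\<close>

lemma (in prob_space) integral_positive_kernel_nonneg:
  fixes K :: "'a \<Rightarrow> 'a \<Rightarrow> complex"
  assumes meas [measurable]: "(\<lambda>(x, y). K x y) \<in> borel_measurable (M \<Otimes>\<^sub>M M)"
    and bound: "\<And>x y. norm (K x y) \<le> B"
    and pos: "\<And>m (y :: nat \<Rightarrow> 'a). 0 \<le> (\<Sum>k<m. \<Sum>j<m. K (y k) (y j))"
  shows "0 \<le> (\<integral>(x, y). K x y \<partial>(M \<Otimes>\<^sub>M M))"
proof -
  interpret MM: pair_prob_space M M ..
  define I where "I = (\<integral>(x, y). K x y \<partial>(M \<Otimes>\<^sub>M M))"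
  define D where "D = (\<integral>x. K x x \<partial>M)"
  have key: "0 \<le> of_nat m * D + of_nat (m * (m - 1)) * I" for m
  proof -
    let ?P = "\<Pi>\<^sub>M k\<in>{..<m}. M"
    interpret P: product_prob_space "\<lambda>_. M" "{..<m}" ..
    have int: "integrable ?P (\<lambda>\<omega>. K (\<omega> k) (\<omega> j))" if "k < m" "j < m" for k j
    proof (rule P.integrable_const_bound[where B = B])
      have "(\<lambda>\<omega>. (\<omega> k, \<omega> j)) \<in> ?P \<rightarrow>\<^sub>M M \<Otimes>\<^sub>M M"
        using that by (intro measurable_Pair measurable_component_singleton) auto
      from measurable_compose[OF this meas] show "(\<lambda>\<omega>. K (\<omega> k) (\<omega> j)) \<in> borel_measurable ?P" by simp
    qed (simp add: bound)
    have diag: "(\<integral>\<omega>. K (\<omega> k) (\<omega> k) \<partial>?P) = D" if "k < m" for k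
    proof -
      have "D = (\<integral>x. K x x \<partial>distr ?P M (\<lambda>\<omega>. \<omega> k))"
        unfolding D_def using that by (subst P.PiM_component) auto
      also have "\<dots> = (\<integral>\<omega>. K (\<omega> k) (\<omega> k) \<partial>?P)"
      proof (rule integral_distr)
        show "(\<lambda>x. K x x) \<in> borel_measurable M"
          using measurable_compose[OF _ meas, of "\<lambda>x. (x, x)" M] by simp
      qed (use that in \<open>auto intro!: measurable_component_singleton\<close>)
      finally show ?thesis ..
    qed
    have off: "(\<integral>\<omega>. K (\<omega> k) (\<omega> j) \<partial>?P) = I" if "k < m" "j < m" "k \<noteq> j" for k j
    proof -
      have "I = (\<integral>z. (case z of (x, y) \<Rightarrow> K x y) \<partial>distr ?P (M \<Otimes>\<^sub>M M) (\<lambda>\<omega>. (\<omega> k, \<omega> j)))"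
        unfolding I_def using that by (subst distr_PiM_pair) auto
      also have "\<dots> = (\<integral>\<omega>. K (\<omega> k) (\<omega> j) \<partial>?P)"
        using that by (subst integral_distr) (auto intro!: measurable_Pair
            measurable_component_singleton)
      finally show ?thesis ..
    qed
    have "0 \<le> (\<integral>\<omega>. (\<Sum>k<m. \<Sum>j<m. K (\<omega> k) (\<omega> j)) \<partial>?P)"
      by (intro complex_integral_nonneg pos Bochner_Integration.integrable_sum int) auto
    also have "\<dots> = (\<Sum>k<m. \<Sum>j<m. \<integral>\<omega>. K (\<omega> k) (\<omega> j) \<partial>?P)"
      by (subst Bochner_Integration.integral_sum; (intro Bochner_Integration.integrable_sum int
          sum.cong refl Bochner_Integration.integral_sum)?) auto
    also have "\<dots> = (\<Sum>k<m. D + (\<Sum>j\<in>{..<m} - {k}. I))"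
      by (intro sum.cong refl, subst sum.remove[of _ "k" for k], simp, assumption)
         (auto simp: diag off)
    also have "\<dots> = of_nat m * D + of_nat (m * (m - 1)) * I"
      by (simp add: algebra_simps)
    finally show ?thesis .
  qed
  have "0 \<le> D" using key[of 1] by simp
  moreover have "0 \<le> of_nat 2 * D + of_nat (2 * (2 - 1)) * I" by (rule key)
  ultimately have Im: "Im I = 0" by (simp add: less_eq_complex_def)
  have "0 \<le> Re I"
  proof (rule ccontr)
    assume neg: "\<not> 0 \<le> Re I"
    obtain n where n: "Re D / (- Re I) < real n" using reals_Archimedean2 by blast
    have "0 \<le> real (Suc n) * Re D + real (Suc n * n) * Re I"
      using key[of "Suc n"] by (simp add: less_eq_complex_def del: of_nat_Suc of_nat_mult)
    also have "\<dots> = real (Suc n) * (Re D + real n * Re I)" by (simp add: algebra_simps)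
    finally have "0 \<le> Re D + real n * Re I" by (simp add: zero_le_mult_iff)
    then show False using n neg by (simp add: field_simps)
  qed
  with Im show ?thesis by (simp add: I_def less_eq_complex_def)
qed

lemma gauss_average_nonneg:
  fixes g :: "'a::euclidean_space \<Rightarrow> complex"
  assumes cont: "continuous_on UNIV g" and bound: "\<And>x. norm (g x) \<le> B" and pd: "positive_definite g"
  shows "0 \<le> (\<integral>z. of_real (gauss z) * (g (a *\<^sub>R (fst z - snd z)) * cis (- (v \<bullet> (fst z -
      snd z)))) \<partial>(lborel :: ('a \<times> 'a) measure))"
proof -
  define G where "G = integral\<^sup>L lborel (gauss :: 'a \<Rightarrow> real)"
  have G: "G > 0" unfolding G_def by (rule integral_gauss_pos)
  define M where "M = density lborel (\<lambda>x::'a. ennreal (gauss x / G))"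
  interpret prob_space M
  proof
    have "emeasure M (space M) = (\<integral>\<^sup>+x. ennreal (gauss (x::'a) / G) \<partial>lborel)"
      by (simp add: M_def emeasure_density)
    also have "\<dots> = ennreal (\<integral>x. gauss (x::'a) / G \<partial>lborel)"
      using G by (intro nn_integral_eq_integral integrable_divide_zero integrable_gauss) auto
    also have "(\<integral>x. gauss (x::'a) / G \<partial>lborel) = 1" using G by (simp add: G_def)
    finally show "emeasure M (space M) = 1" by simp
  qed
  define K where "K = (\<lambda>x y. g (a *\<^sub>R (x - y)) * cis (- (v \<bullet> (x - y))))"
  have contK: "continuous_on UNIV (\<lambda>z. K (fst z) (snd z))"
    unfolding K_def by (intro continuous_intros continuous_on_compose2[OF cont]) auto
  have measK: "(\<lambda>(x, y). K x y) \<in> borel_measurable (borel \<Otimes>\<^sub>M borel)"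
    using borel_measurable_continuous_onI[OF contK] by (simp add: borel_prod case_prod_beta)
  have setsM: "sets (M \<Otimes>\<^sub>M M) = sets (borel \<Otimes>\<^sub>M borel)"
    by (intro sets_pair_measure_cong) (simp_all add: M_def)
  have "0 \<le> (\<integral>(x, y). K x y \<partial>(M \<Otimes>\<^sub>M M))"
  proof (rule integral_positive_kernel_nonneg)
    show "(\<lambda>(x, y). K x y) \<in> borel_measurable (M \<Otimes>\<^sub>M M)"
      using measK measurable_cong_sets[OF setsM refl] by blast
    show "norm (K x y) \<le> B" for x y using bound by (simp add: K_def norm_mult)
    fix m and y :: "nat \<Rightarrow> 'a"
    have "0 \<le> (\<Sum>k<m. \<Sum>j<m. cis (- (v \<bullet> y k)) * cnj (cis (- (v \<bullet> y j))) * g (a *\<^sub>R y k - a *\<^sub>R y j))"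
      using pd[unfolded positive_definite_def, rule_format, where \<xi> = "\<lambda>k. cis (- (v \<bullet> y k))" and y
          = "\<lambda>k. a *\<^sub>R y k"] .
    also have "\<dots> = (\<Sum>k<m. \<Sum>j<m. K (y k) (y j))"
      by (intro sum.cong refl) (simp add: K_def cis_cnj cis_mult inner_diff_right scaleR_diff_right
          algebra_simps)
    finally show "0 \<le> (\<Sum>k<m. \<Sum>j<m. K (y k) (y j))" .
  qed
  also have "M \<Otimes>\<^sub>M M = density (lborel \<Otimes>\<^sub>M lborel) (\<lambda>(x, y). ennreal (gauss x / G) *
      ennreal (gauss y / G))"
    unfolding M_def
  proof (rule pair_measure_density)
    show "sigma_finite_measure (density lborel (\<lambda>x::'a. ennreal (gauss x / G)))"
      using sigma_finite_measure_axioms by (simp add: M_def)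
  qed (auto intro: lborel.sigma_finite_measure_axioms)
  also have "\<dots> = density lborel (\<lambda>z. ennreal (gauss z / G\<^sup>2))"
    unfolding lborel_prod using G gauss_pos
    by (intro arg_cong2[where f = density])
       (auto simp: fun_eq_iff gauss_Pair power2_eq_square less_imp_le simp flip: ennreal_mult)
  also have "(\<integral>(x, y). K x y \<partial>density lborel (\<lambda>z. ennreal (gauss z / G\<^sup>2)))
      = (\<integral>z. (gauss z / G\<^sup>2) *\<^sub>R (case z of (x, y) \<Rightarrow> K x y) \<partial>lborel)"
    using measK G gauss_pos
    by (intro integral_density) (auto simp: borel_prod less_imp_le)
  also have "\<dots> = (\<integral>z. of_real (1 / G\<^sup>2) * (of_real (gauss z) * K (fst z) (snd z)) \<partial>lborel)"
    by (intro Bochner_Integration.integral_cong refl) (simp add: scaleR_conv_of_real case_prod_beta)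
  also have "\<dots> = of_real (1 / G\<^sup>2) * (\<integral>z. of_real (gauss z) * K (fst z) (snd z) \<partial>lborel)"
    by (rule integral_mult_right_zero)
  finally have "0 \<le> of_real (1 / G\<^sup>2) * (\<integral>z. of_real (gauss z) * K (fst z) (snd z) \<partial>lborel)" .
  moreover have "0 \<le> z" if "0 \<le> of_real r * z" "r > 0" for r :: real and z :: complex
    using that by (auto simp: less_eq_complex_def zero_le_mult_iff)
  ultimately have "0 \<le> (\<integral>z. of_real (gauss z) * K (fst z) (snd z) \<partial>lborel)"
    using G by (metis zero_less_divide_1_iff zero_less_power)
  then show ?thesis by (simp only: K_def)
qed

text \<open>This substitute for Bochner's theorem avoids compactness of families of measures.\<close>

theorem positive_definite_limit_of_fourier_transforms:
  fixes g :: "'a::euclidean_space \<Rightarrow> complex"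
  assumes cont: "continuous_on UNIV g" and bound: "\<And>x. norm (g x) \<le> B" and pd: "positive_definite g"
  shows "\<exists>M :: nat \<Rightarrow> 'a measure. (\<forall>N. finite_measure (M N) \<and> sets (M N) = sets borel) \<and>
           (\<forall>y. (\<lambda>N. \<integral>\<xi>. cis (\<xi> \<bullet> y) \<partial>M N) \<longlonglongrightarrow> g y)"
proof -
  define L where "L = (\<lambda>N. real (Suc N))"
  have L: "L N > 0" for N by (simp add: L_def)
  define c where "c = sqrt (2 * pi) ^ DIM('a)"
  have c: "c > 0" by (simp add: c_def)
  define E where "E = (\<lambda>N (z::'a \<times> 'a) (v::'a). g (L N *\<^sub>R (fst z - snd z)) * cis (- (v \<bullet> ((L N *
      L N) *\<^sub>R (fst z - snd z)))))"
  define \<Phi> where "\<Phi> = (\<lambda>N v. \<integral>z. of_real (gauss z) * E N z v \<partial>lborel)"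
  have E_bound: "norm (E N z v) \<le> B" for N z v using bound by (simp add: E_def norm_mult)
  have E_cont: "continuous_on UNIV (\<lambda>p. E N (snd p) (fst p))" for N
    unfolding E_def by (intro continuous_intros continuous_on_compose2[OF cont]) auto
  have \<Phi>_nonneg: "0 \<le> \<Phi> N v" for N v
  proof -
    have "\<Phi> N v = (\<integral>z. of_real (gauss z) * (g (L N *\<^sub>R (fst z - snd z)) * cis (- (((L N *
        L N) *\<^sub>R v) \<bullet> (fst z - snd z)))) \<partial>lborel)"
      by (simp add: \<Phi>_def E_def)
    then show ?thesis using gauss_average_nonneg[OF assms] by (simp only:)
  qed
  have \<Phi>_real: "\<Phi> N v = of_real (Re (\<Phi> N v))" "0 \<le> Re (\<Phi> N v)" for N v
    using \<Phi>_nonneg[of N v] by (auto simp: less_eq_complex_def complex_eq_iff)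
  define F where "F = (\<lambda>N y (p :: 'a \<times> 'a \<times> 'a). complex_of_real (gauss p) * (E N (snd p) (fst p) *
      cis (L N * (fst p \<bullet> y))))"
  have F_int: "integrable (lborel \<Otimes>\<^sub>M lborel) (F N y)" for N y
    unfolding F_def lborel_prod
  proof (rule integrable_gauss_bounded[where B = B])
    show "(\<lambda>p. E N (snd p) (fst p) * cis (L N * (fst p \<bullet> y))) \<in> borel_measurable borel"
      by (intro borel_measurable_continuous_onI continuous_intros E_cont)
  qed (simp add: norm_mult E_bound)
  have F_eq: "F N y (v, z) = of_real (gauss v) * cis (L N * (v \<bullet> y)) * (of_real (gauss z) *
      E N z v)" for N y v z
    by (simp add: F_def gauss_Pair)
  have F_fst: "(\<integral>z. F N y (v, z) \<partial>lborel)
      = of_real (gauss v) * \<Phi> N v * cis (L N * (v \<bullet> y))" for N y v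
    unfolding F_eq \<Phi>_def by (subst integral_mult_right_zero) (simp add: mult_ac)
  have int1: "integrable lborel (\<lambda>v. of_real (gauss v) * \<Phi> N v)" for N
    using lborel_pair.integrable_fst'[OF F_int[of N 0]] by (simp add: F_fst)
  have int2: "integrable lborel (\<lambda>v. gauss v * Re (\<Phi> N v))" for N
    using integrable_Re[OF int1[of N]] by simp
  have main: "(\<integral>v. of_real (gauss v) * \<Phi> N v * cis (L N * (v \<bullet> y)) \<partial>lborel)
     = of_real (c * (1 / (L N * L N)) ^ DIM('a)) *
       (\<integral>p. of_real (gauss p) * (of_real (gauss (fst p + (1 / L N) *\<^sub>R y + (1 / (L N *
           L N)) *\<^sub>R snd p)) * g (y + (1 / L N) *\<^sub>R snd p)) \<partial>(lborel :: ('a \<times> 'a) measure))"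
    for N y
  proof -
    define h where "h = (\<lambda>w. g (L N *\<^sub>R w) * of_real (gauss (L N *\<^sub>R (y - L N *\<^sub>R w))))"
    have h_cont: "continuous_on UNIV h" unfolding h_def
      by (intro continuous_intros continuous_on_compose2[OF cont]) auto
    have h_bound: "norm (h w) \<le> B" for w
    proof -
      have "norm (h w) \<le> B * 1" unfolding h_def norm_mult using gauss_le_1 gauss_pos
        by (intro mult_mono bound) (auto simp: less_imp_le intro: order_trans[OF norm_ge_zero
            bound])
      then show ?thesis by simp
    qed
    have "(\<integral>v. of_real (gauss v) * \<Phi> N v * cis (L N * (v \<bullet> y)) \<partial>lborel)
        = (\<integral>v. (\<integral>z. F N y (v, z) \<partial>lborel) \<partial>lborel)"
      by (simp only: F_fst)
    also have "\<dots> = (\<integral>z. (\<integral>v. F N y (v, z) \<partial>lborel) \<partial>lborel)"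
      using lborel_pair.Fubini_integral[of "\<lambda>v z. F N y (v, z)"] F_int[of N y] by simp
    also have "\<dots> = (\<integral>z. of_real c * (of_real (gauss z) * h (fst z - snd z)) \<partial>lborel)"
    proof (intro Bochner_Integration.integral_cong refl)
      fix z :: "'a \<times> 'a"
      define w where "w = fst z - snd z"
      have "F N y (v, z) = (of_real (gauss z) * g (L N *\<^sub>R w)) * (of_real (gauss v) *
          cis (v \<bullet> (L N *\<^sub>R (y - L N *\<^sub>R w))))" for v
        unfolding F_eq E_def
        by (simp add: w_def[symmetric] cis_mult inner_diff_right scaleR_diff_right algebra_simps)
      then have "(\<integral>v. F N y (v, z) \<partial>lborel)
          = (of_real (gauss z) * g (L N *\<^sub>R w)) * of_real (c * gauss (L N *\<^sub>R (y - L N *\<^sub>R w)))"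
        by (simp only: integral_mult_right_zero integral_gauss_cis c_def)
      then show "(\<integral>v. F N y (v, z) \<partial>lborel) = of_real c * (of_real (gauss z) * h (fst z - snd z))"
        by (simp add: h_def w_def)
    qed
    also have "\<dots> = of_real c * (\<integral>z. of_real (gauss z) * h (fst z - snd z) \<partial>lborel)"
      by (rule integral_mult_right_zero)
    also have "(\<integral>z. of_real (gauss z) * h (fst z - snd z) \<partial>lborel)
        = (\<integral>x'. (\<integral>x. of_real (gauss (x, x')) * h (x - x') \<partial>lborel) \<partial>lborel)"
    proof -
      have "integrable (lborel \<Otimes>\<^sub>M lborel) (\<lambda>z. of_real (gauss z) * h (fst z - snd z))"
        unfolding lborel_prod
        by (intro integrable_gauss_bounded[where B = B] h_bound borel_measurable_continuous_onI
             continuous_on_compose2[OF h_cont] continuous_intros) auto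
      moreover have eq: "(\<lambda>z. of_real (gauss z) * h (fst z - snd z))
          = (\<lambda>(x, x'). of_real (gauss (x, x')) * h (x - x'))"
        by (simp add: fun_eq_iff)
      ultimately show ?thesis
        using lborel_pair.integral_snd[of "\<lambda>x x'. of_real (gauss (x, x')) * h (x - x')"]
        by (simp only: eq lborel_prod)
    qed
    also have "\<dots> = (\<integral>x'. of_real ((1 / (L N * L N)) ^ DIM('a)) *
        (\<integral>s. of_real (gauss (x', s)) * (of_real (gauss (x' + (1 / L N) *\<^sub>R y + (1 / (L N *
            L N)) *\<^sub>R s)) * g (y + (1 / L N) *\<^sub>R s)) \<partial>lborel) \<partial>lborel)"
    proof (intro Bochner_Integration.integral_cong refl)
      fix x' :: 'a
      have hs: "h (x' + (1 / L N) *\<^sub>R y + (1 / (L N * L N)) *\<^sub>R s - x')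
          = g (y + (1 / L N) *\<^sub>R s) * of_real (gauss s)" for s
        using L[of N] gauss_minus[of s] by (simp add: h_def scaleR_add_right)
      have abs_L: "\<bar>1 / (L N * L N)\<bar> = 1 / (L N * L N)" using L[of N] by simp
      have "(\<integral>x. of_real (gauss (x, x')) * h (x - x') \<partial>lborel)
         = of_real (\<bar>1 / (L N * L N)\<bar> ^ DIM('a)) *
           (\<integral>s. of_real (gauss (x' + (1 / L N) *\<^sub>R y + (1 / (L N * L N)) *\<^sub>R s, x')) * h (x' +
               (1 / L N) *\<^sub>R y + (1 / (L N * L N)) *\<^sub>R s - x') \<partial>lborel)"
        using L[of N]
        by (intro lborel_integral_affine borel_measurable_continuous_onI continuous_intros
            continuous_on_compose2[OF h_cont]) auto
      then show "(\<integral>x. of_real (gauss (x, x')) * h (x - x') \<partial>lborel)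
          = of_real ((1 / (L N * L N)) ^ DIM('a)) *
        (\<integral>s. of_real (gauss (x', s)) * (of_real (gauss (x' + (1 / L N) *\<^sub>R y + (1 / (L N *
            L N)) *\<^sub>R s)) * g (y + (1 / L N) *\<^sub>R s)) \<partial>lborel)"
        unfolding hs abs_L by (simp only: gauss_Pair of_real_mult mult_ac)
    qed
    also have "\<dots> = of_real ((1 / (L N * L N)) ^ DIM('a)) *
      (\<integral>x'. (\<integral>s. of_real (gauss (x', s)) * (of_real (gauss (x' + (1 / L N) *\<^sub>R y + (1 / (L N *
          L N)) *\<^sub>R s)) * g (y + (1 / L N) *\<^sub>R s)) \<partial>lborel) \<partial>lborel)"
      by (rule integral_mult_right_zero)
    also have "(\<integral>x'. (\<integral>s. of_real (gauss (x', s)) * (of_real (gauss (x' + (1 / L N) *\<^sub>R y +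
        (1 / (L N * L N)) *\<^sub>R s)) * g (y + (1 / L N) *\<^sub>R s)) \<partial>lborel) \<partial>lborel)
      = (\<integral>p. of_real (gauss p) * (of_real (gauss (fst p + (1 / L N) *\<^sub>R y + (1 / (L N *
          L N)) *\<^sub>R snd p)) * g (y + (1 / L N) *\<^sub>R snd p)) \<partial>lborel)"
    proof -
      have "integrable (lborel \<Otimes>\<^sub>M lborel) (\<lambda>p. of_real (gauss p) * (of_real (gauss (fst p +
          (1 / L N) *\<^sub>R y + (1 / (L N * L N)) *\<^sub>R snd p)) * g (y + (1 / L N) *\<^sub>R snd p)))"
        unfolding lborel_prod
      proof (rule integrable_gauss_bounded[where B = B])
        fix p :: "'a \<times> 'a"
        have "norm (of_real (gauss (fst p + (1 / L N) *\<^sub>R y + (1 / (L N * L N)) *\<^sub>R snd p)) * g (y +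
            (1 / L N) *\<^sub>R snd p)) \<le> 1 * B"
          unfolding norm_mult using gauss_le_1 gauss_pos
            by (intro mult_mono bound) (auto simp: less_imp_le)
        then show "norm (of_real (gauss (fst p + (1 / L N) *\<^sub>R y + (1 / (L N * L N)) *\<^sub>R snd p)) *
            g (y + (1 / L N) *\<^sub>R snd p)) \<le> B" by simp
      qed (intro borel_measurable_continuous_onI continuous_intros continuous_on_compose2[OF cont],
          auto)
      from lborel_pair.integral_fst'[OF this] show ?thesis by (simp add: lborel_prod)
    qed
    finally show ?thesis by (simp only: of_real_mult mult.assoc)
  qed
  define c' where "c' = (\<integral>p. gauss p * gauss (fst p) \<partial>(lborel :: ('a \<times> 'a) measure))"
  have int_c': "integrable lborel (\<lambda>p::'a \<times> 'a. gauss p * gauss (fst p))"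
  proof (rule Bochner_Integration.integrable_bound[OF integrable_gauss])
    have "(\<lambda>p::'a \<times> 'a. gauss p * gauss (fst p)) \<in> borel_measurable borel"
      by (intro borel_measurable_continuous_onI continuous_intros)
    then show "(\<lambda>p::'a \<times> 'a. gauss p * gauss (fst p)) \<in> borel_measurable lborel" by simp
  qed (auto simp: abs_mult gauss_le_1 mult_left_le)
  have c': "c' > 0"
  proof -
    have "c' \<noteq> 0"
    proof
      assume "c' = 0"
      then have "AE p in lborel. gauss p * gauss (fst (p :: 'a \<times> 'a)) = 0"
        using integral_nonneg_eq_0_iff_AE[OF int_c'] by (simp add: c'_def)
      then have "AE p in (lborel :: ('a \<times> 'a) measure). False"
        by (rule AE_mp) (auto simp: gauss_pos less_imp_neq[symmetric])
      then show False by (simp add: AE_iff_null null_sets_def emeasure_lborel_UNIV)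
    qed
    moreover have "c' \<ge> 0" unfolding c'_def by (intro Bochner_Integration.integral_nonneg) auto
    ultimately show ?thesis by simp
  qed
  have lim: "(\<lambda>N. \<integral>p. of_real (gauss p) * (of_real (gauss (fst p + (1 / L N) *\<^sub>R y + (1 / (L N *
      L N)) *\<^sub>R snd p)) * g (y + (1 / L N) *\<^sub>R snd p)) \<partial>(lborel :: ('a \<times> 'a) measure))
     \<longlonglongrightarrow> of_real c' * g y" for y
  proof -
    define r where "r = (\<lambda>t (p :: 'a \<times> 'a). complex_of_real (gauss p) * (of_real (gauss (fst p +
        t *\<^sub>R y + (t * t) *\<^sub>R snd p)) * g (y + t *\<^sub>R snd p)))"
    have "(\<lambda>N. \<integral>p. r (1 / L N) p \<partial>lborel) \<longlonglongrightarrow> (\<integral>p. r 0 p \<partial>lborel)"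
    proof (rule integral_dominated_convergence)
      have meas: "r t \<in> borel_measurable borel" for t
        unfolding r_def by (intro borel_measurable_continuous_onI continuous_intros
            continuous_on_compose2[OF cont]) auto
      then show "r 0 \<in> borel_measurable lborel" "r (1 / L N) \<in> borel_measurable lborel" for N by
          simp_all
      show "integrable lborel (\<lambda>p::'a \<times> 'a. gauss p * B)"
        by (intro integrable_mult_left integrable_gauss)
      have L_lim: "(\<lambda>N. 1 / L N) \<longlonglongrightarrow> 0"
        unfolding L_def using LIMSEQ_inverse_real_of_nat by (simp add: inverse_eq_divide)
      show "AE p in lborel. (\<lambda>N. r (1 / L N) p) \<longlonglongrightarrow> r 0 p"
      proof (intro AE_I2)
        fix p
        have "continuous_on UNIV (\<lambda>t. r t p)"
          unfolding r_def by (intro continuous_intros continuous_on_compose2[OF cont]) auto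
        then have "isCont (\<lambda>t. r t p) 0" by (simp add: continuous_on_eq_continuous_at)
        then show "(\<lambda>N. r (1 / L N) p) \<longlonglongrightarrow> r 0 p"
          using L_lim by (rule isCont_tendsto_compose)
      qed
      show "AE p in lborel. norm (r (1 / L N) p) \<le> gauss p * B" for N
      proof (intro AE_I2)
        fix p
        have "norm (r (1 / L N) p) \<le> gauss p * (1 * B)"
          unfolding r_def norm_mult norm_of_real abs_gauss
            by (intro mult_mono bound mult_left_mono gauss_le_1) auto
        then show "norm (r (1 / L N) p) \<le> gauss p * B" by simp
      qed
    qed
    moreover have "(\<integral>p. r 0 p \<partial>lborel) = of_real c' * g y"
    proof -
      have "(\<integral>p. r 0 p \<partial>lborel) = (\<integral>p. complex_of_real (gauss (p :: 'a \<times> 'a) * gauss (fst p)) *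
          g y \<partial>lborel)"
        by (intro Bochner_Integration.integral_cong refl) (simp add: r_def)
      also have "\<dots> = (\<integral>p. complex_of_real (gauss (p :: 'a \<times> 'a) * gauss (fst p)) \<partial>lborel) * g y"
        by (rule integral_mult_left_zero)
      finally show ?thesis by (simp only: integral_complex_of_real c'_def)
    qed
    ultimately show ?thesis by (simp add: r_def)
  qed
  define W where "W = (\<lambda>N v. (L N * L N) ^ DIM('a) / (c * c') * (gauss v * Re (\<Phi> N v)))"
  have W: "integrable lborel (W N)" "0 \<le> W N v" for N v
    unfolding W_def using int2[of N] L[of N] c c' \<Phi>_real(2)[of N v]
    by (auto intro!: mult_nonneg_nonneg divide_nonneg_nonneg)
  have W_meas [measurable]: "W N \<in> borel_measurable borel" for N
    using borel_measurable_integrable[OF W(1)[of N]] by simp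
  define M where "M = (\<lambda>N. distr (density lborel (\<lambda>v. ennreal (W N v))) borel (\<lambda>v. L N *\<^sub>R v))"
  have M_finite: "finite_measure (M N)" for N
  proof -
    have "emeasure (density lborel (\<lambda>v. ennreal (W N v))) UNIV = (\<integral>\<^sup>+v. ennreal (W N v) \<partial>lborel)"
      by (simp add: emeasure_density)
    also have "\<dots> = ennreal (\<integral>v. W N v \<partial>lborel)"
      by (intro nn_integral_eq_integral W AE_I2)
    finally have "finite_measure (density lborel (\<lambda>v. ennreal (W N v)))"
      by (intro finite_measureI) simp
    then show ?thesis unfolding M_def by (intro finite_measure.finite_measure_distr) simp_all
  qed
  have M_int: "(\<integral>\<xi>. cis (\<xi> \<bullet> y) \<partial>M N) = of_real (1 / c') *
      (\<integral>p. of_real (gauss p) * (of_real (gauss (fst p + (1 / L N) *\<^sub>R y + (1 / (L N *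
          L N)) *\<^sub>R snd p)) * g (y + (1 / L N) *\<^sub>R snd p)) \<partial>(lborel :: ('a \<times> 'a) measure))"
    for N y
  proof -
    have cis_meas: "(\<lambda>\<xi>. cis (\<xi> \<bullet> y)) \<in> borel_measurable borel"
      by (intro borel_measurable_continuous_onI continuous_intros)
    have "(\<integral>\<xi>. cis (\<xi> \<bullet> y) \<partial>M N) = (\<integral>v. cis ((L N *\<^sub>R v) \<bullet> y) \<partial>density lborel (\<lambda>v. ennreal (W N
        v)))"
      unfolding M_def by (rule integral_distr[OF _ cis_meas]) simp
    also have "\<dots> = (\<integral>v. W N v *\<^sub>R cis ((L N *\<^sub>R v) \<bullet> y) \<partial>lborel)"
      using W(2) by (intro integral_density) (auto intro!: borel_measurable_continuous_onI
          continuous_intros)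
    also have "\<dots> = (\<integral>v. of_real ((L N * L N) ^ DIM('a) / (c * c')) * (of_real (gauss v) * \<Phi> N v *
        cis (L N * (v \<bullet> y))) \<partial>lborel)"
      by (intro Bochner_Integration.integral_cong refl, subst \<Phi>_real(1)) (simp add: W_def
          scaleR_conv_of_real)
    also have "\<dots> = of_real ((L N * L N) ^ DIM('a) / (c * c')) * (\<integral>v. of_real (gauss v) * \<Phi> N v *
        cis (L N * (v \<bullet> y)) \<partial>lborel)"
      by (rule integral_mult_right_zero)
    also have "\<dots> = of_real ((L N * L N) ^ DIM('a) / (c * c') * (c * (1 / (L N * L N)) ^ DIM('a))) *
       (\<integral>p. of_real (gauss p) * (of_real (gauss (fst p + (1 / L N) *\<^sub>R y + (1 / (L N *
           L N)) *\<^sub>R snd p)) * g (y + (1 / L N) *\<^sub>R snd p)) \<partial>(lborel :: ('a \<times> 'a) measure))"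
      unfolding main of_real_mult by (simp only: mult.assoc)
    also have "(L N * L N) ^ DIM('a) / (c * c') * (c * (1 / (L N * L N)) ^ DIM('a)) = 1 / c'"
      using L[of N] c by (simp add: power_one_over)
    finally show ?thesis .
  qed
  have "(\<lambda>N. \<integral>\<xi>. cis (\<xi> \<bullet> y) \<partial>M N) \<longlonglongrightarrow> g y" for y
  proof -
    have "(\<lambda>N. \<integral>\<xi>. cis (\<xi> \<bullet> y) \<partial>M N) \<longlonglongrightarrow> of_real (1 / c') * (of_real c' * g y)"
      unfolding M_int by (intro tendsto_mult tendsto_const lim)
    then show ?thesis using c' by simp
  qed
  moreover have "sets (M N) = sets borel" for N by (simp add: M_def)
  ultimately show ?thesis using M_finite by blast
qed

subsection \<open>Averaging over rotations\<close>

lemma upper_density_zeroD: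
  assumes "upper_density l = 0" "\<eta> > 0"
  shows "\<exists>r0. \<forall>r\<ge>r0. \<forall>a. finite {k. l k \<in> {a..a + r}} \<and> real (card {k. l k \<in> {a..a + r}}) \<le> \<eta> * r"
proof -
  have "\<forall>\<^sub>F r in at_top. interval_count l r / ennreal r < ennreal \<eta>"
    using upper_density_tendsto[of l] assms by (intro order_tendstoD(2)) auto
  then have "\<forall>\<^sub>F r in at_top. interval_count l r / ennreal r < ennreal \<eta> \<and> r > 0"
    using eventually_gt_at_top[of "0::real"] by eventually_elim simp
  then obtain r0 where r0: "\<And>r. r \<ge> r0 \<Longrightarrow> interval_count l r / ennreal r < ennreal \<eta>" "\<And>r. r \<ge> r0
      \<Longrightarrow> r > 0"
    by (auto simp: eventually_at_top_linorder)
  have "finite {k. l k \<in> {a..a + r}}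
      \<and> real (card {k. l k \<in> {a..a + r}}) \<le> \<eta> * r" if r: "r \<ge> r0" for r a
  proof -
    let ?S = "{k. l k \<in> {a..a + r}}"
    have le: "emeasure (count_space UNIV) ?S \<le> interval_count l r"
      unfolding interval_count_def by (rule SUP_upper) simp
    obtain c where c: "interval_count l r = ennreal c" "c \<ge> 0"
      using r0[OF r] by (cases "interval_count l r") (auto simp: ennreal_top_divide)
    have "c < \<eta> * r"
      using r0[OF r] c assms(2) by (simp add: divide_ennreal ennreal_less_iff field_simps)
    have "finite ?S"
    proof (rule ccontr)
      assume "infinite ?S"
      then have "emeasure (count_space UNIV) ?S = \<infinity>" by (intro emeasure_count_space_infinite) auto
      with le c show False by (simp add: top_unique)
    qed
    moreover from this have "ennreal (real (card ?S)) \<le> ennreal c"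
      using le c by (simp add: ennreal_of_nat_eq_real_of_nat)
    then have "real (card ?S) \<le> c" using c by simp
    ultimately show ?thesis using \<open>c < \<eta> * r\<close> by simp
  qed
  then show ?thesis by blast
qed

lemma separation_le:
  assumes "i \<noteq> j" shows "separation l \<le> \<bar>l i - l j\<bar>"
  unfolding separation_def
proof (rule cINF_lower2[where x = "(i, j)"])
  show "bdd_below ((\<lambda>(k, j). \<bar>l k - l j\<bar>) ` {(k, j). k \<noteq> j})"
    by (rule bdd_belowI[of _ 0]) auto
qed (use assms in auto)

lemma integral_circle_ge:
  fixes H :: "real \<Rightarrow> real"
  assumes cont: "continuous_on UNIV H" and nn: "\<And>t. 0 \<le> H t" and \<phi>: "0 \<le> \<phi>" "\<phi> \<le> 2 * pi"
  shows "2 / pi * integral {-(pi/2)..pi/2} (\<lambda>t. H (2 * \<rho> / pi * t))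
      \<le> integral {-pi..3 * pi} (\<lambda>\<theta>. H (\<rho> * sin (\<theta> - \<phi>)))"
proof -
  let ?g = "\<lambda>\<theta>. pi / 2 * sin (\<theta> - \<phi>)" and ?J = "{\<phi> - pi/2..\<phi> + pi/2}"
  let ?f = "\<lambda>t. H (2 * \<rho> / pi * t)"
  have contH: "continuous_on S (\<lambda>t. H (u t))" if "continuous_on S u" for u :: "real \<Rightarrow> real" and S
    using that by (intro continuous_on_compose2[OF cont]) auto
  have "((\<lambda>\<theta>. (pi / 2 * cos (\<theta> - \<phi>)) *\<^sub>R ?f (?g \<theta>))
      has_integral integral {?g (\<phi> - pi/2)..?g (\<phi> + pi/2)} ?f) ?J"
  proof (rule has_integral_substitution)
    show "?g ` ?J \<subseteq> {-(pi/2)..pi/2}"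
    proof safe
      fix \<theta>
      have "\<bar>?g \<theta>\<bar> \<le> pi / 2 * 1" unfolding abs_mult by (intro mult_mono) auto
      then show "?g \<theta> \<in> {-(pi/2)..pi/2}" by (simp only: abs_le_iff atLeastAtMost_iff) auto
    qed
  qed (auto intro!: contH continuous_intros derivative_eq_intros)
  moreover have "?g (\<phi> - pi/2) = -(pi/2)" "?g (\<phi> + pi/2) = pi/2" by simp_all
  ultimately have "((\<lambda>\<theta>. pi / 2 * cos (\<theta> - \<phi>) * H (\<rho> * sin (\<theta> - \<phi>)))
      has_integral integral {-(pi/2)..pi/2} ?f) ?J"
    by simp
  then have "((\<lambda>\<theta>. 2 / pi * (pi / 2 * cos (\<theta> - \<phi>) * H (\<rho> * sin (\<theta> - \<phi>))))
      has_integral 2 / pi * integral {-(pi/2)..pi/2} ?f) ?J"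
    by (rule has_integral_mult_right)
  then have "2 / pi * integral {-(pi/2)..pi/2} ?f
      = integral ?J (\<lambda>\<theta>. 2 / pi * (pi / 2 * cos (\<theta> - \<phi>) * H (\<rho> * sin (\<theta> - \<phi>))))"
    by (rule integral_unique[symmetric])
  also have "\<dots> \<le> integral ?J (\<lambda>\<theta>. H (\<rho> * sin (\<theta> - \<phi>)))"
  proof (rule integral_le)
    fix \<theta>
    show "2 / pi * (pi / 2 * cos (\<theta> - \<phi>) * H (\<rho> * sin (\<theta> - \<phi>))) \<le> H (\<rho> * sin (\<theta> - \<phi>))"
      using mult_right_mono[OF cos_le_one nn] by simp
  qed (intro integrable_continuous_interval continuous_intros contH)+
  also have "\<dots> \<le> integral {-pi..3 * pi} (\<lambda>\<theta>. H (\<rho> * sin (\<theta> - \<phi>)))"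
    using \<phi> by (intro integral_subset_le integrable_continuous_interval continuous_intros contH)
        (auto intro: nn)
  finally show ?thesis .
qed

text \<open>This is a rotation only on the vectors orthogonal to \<open>a\<close>: the term for the image of \<open>a\<close> is
    omitted.\<close>

definition plane_rotation :: "'a::real_inner \<Rightarrow> 'a \<Rightarrow> real \<Rightarrow> 'a \<Rightarrow> 'a" where
  "plane_rotation a b \<theta> v = v - (v \<bullet> b) *\<^sub>R b + (v \<bullet> b) *\<^sub>R (sin \<theta> *\<^sub>R a + cos \<theta> *\<^sub>R b)"

lemma plane_rotation_diff: "plane_rotation a b \<theta> (v - w)
    = plane_rotation a b \<theta> v - plane_rotation a b \<theta> w"
  by (simp add: plane_rotation_def inner_diff_left scaleR_diff_left algebra_simps)

lemma norm_plane_rotation: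
  assumes "norm a = 1" "norm b = 1" "a \<bullet> b = 0" "v \<bullet> a = 0"
  shows "norm (plane_rotation a b \<theta> v) = norm v"
proof -
  define w where "w = v - (v \<bullet> b) *\<^sub>R b"
  have ab: "a \<bullet> a = 1" "b \<bullet> b = 1" "b \<bullet> a = 0"
    using assms by (auto simp: dot_square_norm inner_commute)
  have w: "w \<bullet> a = 0" "w \<bullet> b = 0" "a \<bullet> w = 0" "b \<bullet> w = 0"
    using assms ab by (simp_all add: w_def inner_diff_left inner_diff_right inner_commute)
  have v: "v = w + (v \<bullet> b) *\<^sub>R b" by (simp add: w_def)
  have sc: "cos \<theta> * (cos \<theta> * X) + sin \<theta> * (sin \<theta> * X) = X" for X :: real
  proof -
    have "cos \<theta> * (cos \<theta> * X) + sin \<theta> * (sin \<theta> * X) = ((cos \<theta>)\<^sup>2 + (sin \<theta>)\<^sup>2) * X"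
      by (simp only: power2_eq_square distrib_right mult.assoc)
    then show ?thesis by simp
  qed
  have "plane_rotation a b \<theta> v \<bullet> plane_rotation a b \<theta> v = w \<bullet> w + (v \<bullet> b)\<^sup>2"
    using w ab assms(3) unfolding plane_rotation_def w_def[symmetric]
    by (simp add: inner_add_left inner_add_right algebra_simps power2_eq_square sc)
  also have "\<dots> = (w + (v \<bullet> b) *\<^sub>R b) \<bullet> (w + (v \<bullet> b) *\<^sub>R b)"
    using w ab by (simp add: inner_add_left inner_add_right power2_eq_square)
  finally show ?thesis using v by (simp add: norm_eq_sqrt_inner)
qed

lemma continuous_on_plane_rotation [continuous_intros]:
  fixes f :: "'b::t2_space \<Rightarrow> real"
  shows "continuous_on S f \<Longrightarrow> continuous_on S (\<lambda>p. plane_rotation a b (f p) v)"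
  unfolding plane_rotation_def by (intro continuous_intros)

lemma circle_mean_exp_sum_ge:
  fixes x :: "nat \<Rightarrow> 'a::euclidean_space"
  assumes l: "\<And>k. x k \<bullet> b = l k"
    and C: "C > 0" "\<And>s K c. s \<ge> 2 * \<rho>0 / pi \<Longrightarrow> finite K \<Longrightarrow> (\<Sum>k\<in>K. (cmod (c k))\<^sup>2)
      \<le> C * integral {-(pi/2)..pi/2} (\<lambda>t. (cmod (\<Sum>k\<in>K. c k * cis (s * l k * t)))\<^sup>2)"
    and u: "\<rho>0 > 0" "\<rho>0\<^sup>2 \<le> (u \<bullet> a)\<^sup>2 + (u \<bullet> b)\<^sup>2"
  shows "2 / (pi * C) * (\<Sum>k<m. (cmod (\<xi> k))\<^sup>2)
    \<le> integral {-pi..3 * pi} (\<lambda>\<theta>. (cmod (\<Sum>k<m. \<xi> k * cis (u \<bullet> plane_rotation a b \<theta> (x k))))\<^sup>2)"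
proof -
  define \<rho> where "\<rho> = sqrt ((u \<bullet> a)\<^sup>2 + (u \<bullet> b)\<^sup>2)"
  have \<rho>: "\<rho>0 \<le> \<rho>" "\<rho> > 0" "\<rho>\<^sup>2 = (u \<bullet> a)\<^sup>2 + (u \<bullet> b)\<^sup>2"
  proof -
    show "\<rho>0 \<le> \<rho>" unfolding \<rho>_def by (rule real_le_rsqrt[OF u(2)])
    with u(1) show "\<rho> > 0" by simp
  qed (simp add: \<rho>_def)
  have "((u \<bullet> a) / \<rho>)\<^sup>2 + (- (u \<bullet> b) / \<rho>)\<^sup>2 = 1"
    using \<rho>(2) by (simp add: power_divide flip: add_divide_distrib \<rho>(3))
  then obtain \<phi> where \<phi>: "0 \<le> \<phi>" "\<phi> < 2 * pi" "(u \<bullet> a) / \<rho> = cos \<phi>" "- (u \<bullet> b) / \<rho> = sin \<phi>"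
    by (rule sincos_total_2pi)
  have ua: "u \<bullet> a = \<rho> * cos \<phi>" and ub: "u \<bullet> b = - (\<rho> * sin \<phi>)"
    using \<phi> \<rho> by (auto simp: field_simps)
  define c where "c = (\<lambda>k. \<xi> k * cis (u \<bullet> (x k - l k *\<^sub>R b)))"
  define H where "H = (\<lambda>t. (cmod (\<Sum>k<m. c k * cis (l k * t)))\<^sup>2)"
  have rot: "\<xi> k * cis (u \<bullet> plane_rotation a b \<theta> (x k))
      = c k * cis (l k * (\<rho> * sin (\<theta> - \<phi>)))" for k \<theta>
  proof -
    have "u \<bullet> plane_rotation a b \<theta> (x k)
        = u \<bullet> (x k - l k *\<^sub>R b) + l k * (sin \<theta> * (u \<bullet> a) + cos \<theta> * (u \<bullet> b))"
      by (simp add: plane_rotation_def l inner_add_right inner_diff_right)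
    also have "sin \<theta> * (u \<bullet> a) + cos \<theta> * (u \<bullet> b) = \<rho> * sin (\<theta> - \<phi>)"
      unfolding ua ub by (simp add: sin_diff algebra_simps)
    finally show ?thesis by (simp add: c_def cis_mult mult.assoc)
  qed
  have "(\<Sum>k<m. (cmod (\<xi> k))\<^sup>2) = (\<Sum>k<m. (cmod (c k))\<^sup>2)"
    by (simp add: c_def norm_mult)
  also have "\<dots> \<le> C * integral {-(pi/2)..pi/2} (\<lambda>t. (cmod (\<Sum>k<m. c k * cis ((2 * \<rho> / pi) * l k *
      t)))\<^sup>2)"
    using \<rho> by (intro C(2)) (auto simp: divide_right_mono)
  also have "(\<lambda>t. (cmod (\<Sum>k<m. c k * cis ((2 * \<rho> / pi) * l k * t)))\<^sup>2) = (\<lambda>t. H (2 * \<rho> / pi * t))"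
    by (simp add: H_def mult_ac)
  finally have "2 / (pi * C) * (\<Sum>k<m. (cmod (\<xi> k))\<^sup>2)
      \<le> 2 / (pi * C) * (C * integral {-(pi/2)..pi/2} (\<lambda>t. H (2 * \<rho> / pi * t)))"
    using C by (intro mult_left_mono) auto
  also have "\<dots> = 2 / pi * integral {-(pi/2)..pi/2} (\<lambda>t. H (2 * \<rho> / pi * t))" using C by simp
  also have "\<dots> \<le> integral {-pi..3 * pi} (\<lambda>\<theta>. H (\<rho> * sin (\<theta> - \<phi>)))"
    unfolding H_def using \<phi> by (intro integral_circle_ge continuous_intros) auto
  finally show ?thesis by (simp only: H_def rot)
qed

lemma integrable_bounded_continuous:
  fixes h :: "'a::topological_space \<Rightarrow> 'b::{banach, second_countable_topology}"
  assumes "finite_measure M" "sets M = sets borel" "continuous_on UNIV h" "\<And>v. norm (h v) \<le> c"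
  shows "integrable M h"
proof -
  interpret finite_measure M by fact
  have "h \<in> borel_measurable borel" by (intro borel_measurable_continuous_onI assms)
  then have "h \<in> borel_measurable M" using measurable_cong_sets[OF assms(2) refl] by blast
  then show ?thesis by (rule integrable_const_bound[rotated]) (use assms in auto)
qed

lemma strongly_positive_definite_of_orthogonal:
  fixes x :: "nat \<Rightarrow> 'a::euclidean_space"
  assumes f: "f \<in> Phi TYPE('a)" and nonconst: "\<not> f constant_on {0..}"
    and ab: "norm a = 1" "norm b = 1" "a \<bullet> b = 0" and xa: "\<And>k. x k \<bullet> a = 0"
    and sep: "separation (\<lambda>k. x k \<bullet> b) > 0" and dens: "upper_density (\<lambda>k. x k \<bullet> b) = 0"
  shows "strongly_positive_definite x f"
proof -
  define g where "g = (\<lambda>v::'a. f (norm v))"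
  have pd: "positive_definite g" and cont: "continuous_on UNIV g"
  proof -
    show "positive_definite g" using f by (simp add: Phi_def g_def)
    have "continuous_on {0..} f" using f by (simp add: Phi_def)
    then show "continuous_on UNIV g" unfolding g_def
      by (rule continuous_on_compose2) (auto intro: continuous_intros)
  qed
  obtain B where B: "\<And>v. norm (g v) \<le> B"
  proof -
    have "bounded (f ` {0..})" using f by (simp add: Phi_def)
    then obtain B where "\<And>t. t \<ge> 0 \<Longrightarrow> norm (f t) \<le> B" unfolding bounded_iff by auto
    then show ?thesis by (intro that[of B]) (simp add: g_def)
  qed
  obtain M :: "nat \<Rightarrow> 'a measure" where M: "\<And>N. finite_measure (M N)" "\<And>N. sets (M N) = sets borel"
    and lim: "\<And>y. (\<lambda>N. \<integral>\<xi>. cis (\<xi> \<bullet> y) \<partial>M N) \<longlonglongrightarrow> g y"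
    using positive_definite_limit_of_fourier_transforms[OF cont B pd] by blast
  have space_M: "space (M N) = UNIV" for N using sets_eq_imp_space_eq[OF M(2)] by simp
  define \<mu> where "\<mu> = (\<lambda>N. measure (M N) UNIV)"
  define G where "G = (\<lambda>N y. \<integral>\<xi>. cis (\<xi> \<bullet> y) \<partial>M N)"
  have G0: "G N 0 = of_real (\<mu> N)" for N
    by (simp add: G_def \<mu>_def space_M scaleR_conv_of_real)
  have G_le: "norm (G N y) \<le> \<mu> N" for N y
  proof -
    have "norm (G N y) \<le> (\<integral>\<xi>. norm (cis (\<xi> \<bullet> y)) \<partial>M N)" unfolding G_def
      by (rule integral_norm_bound)
    then show ?thesis by (simp add: \<mu>_def space_M)
  qed
  have lim_G: "(\<lambda>N. G N y) \<longlonglongrightarrow> g y" for y using lim by (simp add: G_def)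
  have lim_\<mu>: "\<mu> \<longlonglongrightarrow> Re (g 0)"
    using tendsto_Re[OF lim_G[of 0]] by (simp add: G0)
  have g_le: "norm (g y) \<le> Re (g 0)" for y
    by (rule LIMSEQ_le[OF tendsto_norm[OF lim_G] lim_\<mu>]) (use G_le in auto)
  have Im_g0: "Im (g 0) = 0"
    using LIMSEQ_unique[OF tendsto_Im[OF lim_G[of 0]]] by (simp add: G0)
  obtain t where t: "t \<ge> 0" "Re (f t) < Re (f 0)"
  proof (rule ccontr)
    assume "\<not> thesis"
    then have ge: "Re (f t) \<ge> Re (f 0)" if "t \<ge> 0" for t
      using that \<open>\<And>t. \<lbrakk>0 \<le> t; Re (f t) < Re (f 0)\<rbrakk> \<Longrightarrow> thesis\<close> by force
    have const: "f t = f 0" if "t \<ge> 0" for t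
    proof -
      have le: "norm (f t) \<le> Re (f 0)" using g_le[of "t *\<^sub>R b"] ab that by (simp add: g_def)
      have "(Re (f t))\<^sup>2 + (Im (f t))\<^sup>2 \<le> (Re (f 0))\<^sup>2"
        using power_mono[OF le, of 2] by (simp add: cmod_power2)
      moreover have "0 \<le> Re (f 0)" using norm_ge_zero le by (rule order_trans)
      then have "(Re (f 0))\<^sup>2 \<le> (Re (f t))\<^sup>2" using ge[OF that] by (intro power_mono) auto
      ultimately have "(Im (f t))\<^sup>2 \<le> 0" by linarith
      then have "Im (f t) = 0" by simp
      moreover have "Re (f t) = Re (f 0)"
        using ge[OF that] complex_Re_le_cmod[of "f t"] le by linarith
      ultimately show ?thesis using Im_g0 by (simp add: complex_eq_iff g_def)
    qed
    have "f constant_on {0..}" unfolding constant_on_def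
      by (intro exI[of _ "f 0"] ballI const) (simp only: atLeast_iff)
    with nonconst show False ..
  qed
  define f0 where "f0 = Re (f 0)"
  define ft where "ft = Re (f t)"
  have norm_tb: "norm (t *\<^sub>R b) = t" using t ab by simp
  have f0: "f0 > 0"
  proof -
    have "norm (f t) \<le> f0" using g_le[of "t *\<^sub>R b"] norm_tb by (simp add: g_def f0_def)
    then have "\<bar>Re (f t)\<bar> \<le> f0" using abs_Re_le_cmod order_trans by blast
    then show ?thesis using t by (auto simp: f0_def)
  qed
  have t0: "t > 0" using t by (cases "t = 0") auto
  define \<epsilon> where "\<epsilon> = (f0 - ft) / (2 * f0)"
  have \<epsilon>: "\<epsilon> > 0" using t f0 by (simp add: \<epsilon>_def f0_def ft_def)
  define \<rho>0 where "\<rho>0 = sqrt (2 * \<epsilon>) / t"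
  have \<rho>0: "\<rho>0 > 0" using \<epsilon> t0 by (simp add: \<rho>0_def)
  obtain C where C: "C > 0" "\<And>s K c. s \<ge> 2 * \<rho>0 / pi \<Longrightarrow> finite K \<Longrightarrow> (\<Sum>k\<in>K. (cmod (c k))\<^sup>2)
      \<le> C * integral {-(pi/2)..pi/2} (\<lambda>r. (cmod (\<Sum>k\<in>K. c k * cis (s * (x k \<bullet> b) * r)))\<^sup>2)"
    using exp_sum_lower_bound[OF sep separation_le upper_density_zeroD[OF dens], of "2 *
        \<rho>0 / pi"] \<rho>0 by auto
  define c0 where "c0 = 2 / (pi * C)"
  have c0: "c0 > 0" using C by (simp add: c0_def)
  define \<kappa> where "\<kappa> = c0 / 2 * ((f0 - ft) / 2) / (4 * pi)"
  have "\<kappa> > 0" using c0 t by (simp add: \<kappa>_def f0_def ft_def)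
  moreover have "(\<Sum>k<m. \<Sum>j<m. \<xi> k * cnj (\<xi> j) * f (norm (x k - x j))) \<ge> complex_of_real (\<kappa> *
      (\<Sum>k<m. (cmod (\<xi> k))\<^sup>2))" for m \<xi>
  proof -
    define Q where "Q = (\<Sum>k<m. \<Sum>j<m. \<xi> k * cnj (\<xi> j) * g (x k - x j))"
    define s where "s = (\<Sum>k<m. (cmod (\<xi> k))\<^sup>2)"
    have s: "s \<ge> 0" by (simp add: s_def sum_nonneg)
    define T where "T = {-pi..3 * pi}"
    define \<tau> where "\<tau> = density lborel (\<lambda>\<theta>. ennreal (indicator T \<theta>))"
    have sets_\<tau>: "sets \<tau> = sets borel" by (simp add: \<tau>_def)
    interpret \<tau>: finite_measure \<tau>
      by (rule finite_measureI) (simp add: \<tau>_def T_def emeasure_density ennreal_indicator)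
    have \<tau>_int: "integral\<^sup>L \<tau> h = integral T h" if "continuous_on UNIV h" for h :: "real \<Rightarrow> real"
    proof -
      have "integral\<^sup>L \<tau> h = (\<integral>\<theta>. indicator T \<theta> *\<^sub>R h \<theta> \<partial>lborel)"
        unfolding \<tau>_def using that
        by (intro integral_density) (auto simp: T_def intro!: borel_measurable_continuous_onI)
      also have "\<dots> = integral T h"
        using set_borel_integral_eq_integral(2)[of T h] borel_integrable_atLeastAtMost'[of "-pi"
            "3*pi" h] continuous_on_subset[OF that]
        by (auto simp: set_lebesgue_integral_def T_def)
      finally show ?thesis .
    qed
    define S where "S = (\<lambda>\<theta> u. (cmod (\<Sum>k<m. \<xi> k * cis (u \<bullet> plane_rotation a b \<theta> (x k))))\<^sup>2)"
    have S_cont: "continuous_on UNIV (\<lambda>p. S (fst p) (snd p))"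
      unfolding S_def by (intro continuous_intros)
    define Bs where "Bs = (\<Sum>k<m. cmod (\<xi> k))\<^sup>2"
    have S_le: "\<bar>S \<theta> u\<bar> \<le> Bs" for \<theta> u
    proof -
      have "cmod (\<Sum>k<m. \<xi> k * cis (u \<bullet> plane_rotation a b \<theta> (x k))) \<le> (\<Sum>k<m. cmod (\<xi> k))"
        by (intro sum_norm_le) (simp add: norm_mult)
      then show ?thesis by (simp add: S_def Bs_def power_mono)
    qed
    define q where "q = (\<lambda>N \<theta>. \<integral>u. S \<theta> u \<partial>M N)"
    have q_eq: "complex_of_real (q N \<theta>)
        = (\<Sum>k<m. \<Sum>j<m. \<xi> k * cnj (\<xi> j) * G N (plane_rotation a b \<theta> (x k - x j)))" for N \<theta>
    proof -
      have "complex_of_real (S \<theta> u) = (\<Sum>k<m. \<Sum>j<m. \<xi> k * cnj (\<xi> j) *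
          cis (u \<bullet> plane_rotation a b \<theta> (x k - x j)))" for u
      proof -
        have "cis (u \<bullet> plane_rotation a b \<theta> (x k - x j))
            = cis (u \<bullet> plane_rotation a b \<theta> (x k)) *
            cnj (cis (u \<bullet> plane_rotation a b \<theta> (x j)))" for k j
          by (simp add: cis_cnj cis_mult plane_rotation_diff inner_diff_right)
        then show ?thesis unfolding S_def complex_norm_square by (simp add: sum_product mult_ac)
      qed
      then have "complex_of_real (q N \<theta>)
          = (\<integral>u. (\<Sum>k<m. \<Sum>j<m. \<xi> k * cnj (\<xi> j) * cis (u \<bullet> plane_rotation a b \<theta> (x k - x j))) \<partial>M N)"
        unfolding q_def by (simp flip: integral_complex_of_real)
      also have "\<dots> = (\<Sum>k<m. \<Sum>j<m. \<xi> k * cnj (\<xi> j) * G N (plane_rotation a b \<theta> (x k - x j)))"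
      proof -
        have i: "integrable (M N) (\<lambda>u. \<xi> k * cnj (\<xi> j) * cis (u \<bullet> plane_rotation a b \<theta> (x k -
            x j)))" for k j
          by (intro integrable_mult_right integrable_bounded_continuous[OF M, where c
              = 1] continuous_intros) auto
        show ?thesis unfolding G_def
          by (subst Bochner_Integration.integral_sum, intro Bochner_Integration.integrable_sum i,
              intro sum.cong refl, subst Bochner_Integration.integral_sum, rule i) (simp only:
                  integral_mult_right_zero)
      qed
      finally show ?thesis .
    qed
    have q_lim: "(\<lambda>N. q N \<theta>) \<longlonglongrightarrow> Re Q" for \<theta>
    proof -
      have "g (plane_rotation a b \<theta> (x k - x j)) = g (x k - x j)" for k j
        using ab xa by (simp add: g_def norm_plane_rotation inner_diff_left)
      then have "(\<lambda>N. complex_of_real (q N \<theta>)) \<longlonglongrightarrow> Q"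
        unfolding q_eq Q_def using lim_G by (auto intro!: tendsto_intros) metis
      from tendsto_Re[OF this] show ?thesis by simp
    qed
    define A where "A = (\<lambda>u. \<integral>\<theta>. S \<theta> u \<partial>\<tau>)"
    have pair_int: "integrable (\<tau> \<Otimes>\<^sub>M M N) (\<lambda>(\<theta>, u). S \<theta> u)" for N
    proof -
      interpret P: finite_measure "\<tau> \<Otimes>\<^sub>M M N"
        by (intro finite_measure_pair_measure M \<tau>.finite_measure_axioms)
      have "sets (\<tau> \<Otimes>\<^sub>M M N) = sets (borel \<Otimes>\<^sub>M borel)"
        by (intro sets_pair_measure_cong sets_\<tau> M)
      then have sets_pair: "sets (\<tau> \<Otimes>\<^sub>M M N) = sets (borel :: (real \<times> 'a) measure)"
        unfolding borel_prod .
      have "(\<lambda>(\<theta>, u). S \<theta> u) \<in> borel_measurable borel"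
        using borel_measurable_continuous_onI[OF S_cont] by (simp add: case_prod_beta)
      then have "(\<lambda>(\<theta>, u). S \<theta> u) \<in> borel_measurable (\<tau> \<Otimes>\<^sub>M M N)"
        using measurable_cong_sets[OF sets_pair refl] by blast
      then show ?thesis by (rule P.integrable_const_bound[rotated, where B = Bs]) (use S_le in auto)
    qed
    have pair: "integrable \<tau> (q N)" "integrable (M N) A" "(\<integral>\<theta>. q N \<theta> \<partial>\<tau>) = (\<integral>u. A u \<partial>M N)" for N
    proof -
      interpret M: finite_measure "M N" by (rule M)
      interpret pair_sigma_finite \<tau> "M N" ..
      show "integrable \<tau> (q N)" using integrable_fst'[OF pair_int] by (simp add: q_def)
      show "integrable (M N) A" using integrable_snd[OF pair_int] by (simp add: A_def)
      show "(\<integral>\<theta>. q N \<theta> \<partial>\<tau>) = (\<integral>u. A u \<partial>M N)" using Fubini_integral[OF pair_int]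
        by (simp add: q_def A_def)
    qed
    have q_bound: "\<bar>q N \<theta>\<bar> \<le> Bs * \<mu> N" for N \<theta>
    proof -
      interpret finite_measure "M N" by (rule M)
      have "\<bar>q N \<theta>\<bar> \<le> (\<integral>u. \<bar>S \<theta> u\<bar> \<partial>M N)"
        unfolding q_def by (rule integral_abs_bound)
      also have "\<dots> \<le> (\<integral>u. Bs \<partial>M N)"
        using S_le by (intro integral_mono integrable_abs integrable_bounded_continuous[OF M, where
            c = Bs] integrable_const)
          (auto simp: S_def intro!: continuous_intros)
      finally show ?thesis by (simp add: \<mu>_def space_M mult.commute)
    qed
    obtain B\<mu> where B\<mu>: "\<And>N. \<bar>\<mu> N\<bar> \<le> B\<mu>"
      using Bseq_def convergent_imp_Bseq[OF convergentI[OF lim_\<mu>]] by (auto simp: Bseq_def)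
    have "(\<lambda>N. \<integral>\<theta>. q N \<theta> \<partial>\<tau>) \<longlonglongrightarrow> (\<integral>\<theta>. Re Q \<partial>\<tau>)"
    proof (rule integral_dominated_convergence)
      show "q N \<in> borel_measurable \<tau>" for N using pair(1) by (rule borel_measurable_integrable)
      show "integrable \<tau> (\<lambda>_. Bs * B\<mu>)" by simp
      show "AE \<theta> in \<tau>. norm (q N \<theta>) \<le> Bs * B\<mu>" for N
      proof (intro AE_I2)
        fix \<theta>
        have "Bs * \<mu> N \<le> Bs * B\<mu>" using B\<mu>[of N] by (intro mult_left_mono) (auto simp: Bs_def)
        then show "norm (q N \<theta>) \<le> Bs * B\<mu>" using q_bound[of N \<theta>] by simp
      qed
    qed (use q_lim in auto)
    also have "(\<integral>\<theta>. Re Q \<partial>\<tau>) = 4 * pi * Re Q"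
      by (subst \<tau>_int) (auto simp: T_def)
    finally have lim_A: "(\<lambda>N. \<integral>u. A u \<partial>M N) \<longlonglongrightarrow> 4 * pi * Re Q" by (simp only: pair(3))
    have A_ge: "c0 / 2 * s * (1 - \<epsilon> - cos (t * (u \<bullet> b))) \<le> A u" for u
    proof -
      have A: "A u = integral T (\<lambda>\<theta>. S \<theta> u)"
        unfolding A_def S_def by (intro \<tau>_int continuous_intros)
      show ?thesis
      proof (cases "\<rho>0\<^sup>2 \<le> (u \<bullet> a)\<^sup>2 + (u \<bullet> b)\<^sup>2")
        case True
        have "c0 * s \<le> A u"
          unfolding A S_def T_def c0_def s_def
          by (rule circle_mean_exp_sum_ge[OF refl C \<rho>0 True])
        moreover have "1 - \<epsilon> - cos (t * (u \<bullet> b)) \<le> 2"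
          using \<epsilon> cos_ge_minus_one[of "t * (u \<bullet> b)"] by linarith
        then have "c0 / 2 * s * (1 - \<epsilon> - cos (t * (u \<bullet> b))) \<le> c0 / 2 * s * 2"
          using c0 s by (intro mult_left_mono) auto
        ultimately show ?thesis by simp
      next
        case False
        define y where "y = t * (u \<bullet> b)"
        have "(u \<bullet> b)\<^sup>2 \<le> \<rho>0\<^sup>2" using False by (smt (verit) zero_le_power2)
        then have "t\<^sup>2 * (u \<bullet> b)\<^sup>2 \<le> t\<^sup>2 * \<rho>0\<^sup>2" by (intro mult_left_mono) auto
        also have "\<dots> = 2 * \<epsilon>" using t0 \<epsilon> by (simp add: \<rho>0_def power_divide)
        finally have y: "y\<^sup>2 \<le> 2 * \<epsilon>" by (simp add: y_def power_mult_distrib)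
        have "1 - cos y = 2 * (sin (y / 2))\<^sup>2" using cos_double_sin[of "y / 2"] by simp
        also have "(sin (y / 2))\<^sup>2 \<le> (y / 2)\<^sup>2"
          using abs_sin_x_le_abs_x[of "y / 2"] by (simp only: abs_le_square_iff)
        finally have "1 - \<epsilon> - cos y \<le> 0" using y by (simp add: power_divide)
        then have "c0 / 2 * s * (1 - \<epsilon> - cos y) \<le> 0" using c0 s by (intro mult_nonneg_nonpos) auto
        also have "0 \<le> A u" unfolding A_def
          by (intro Bochner_Integration.integral_nonneg) (simp add: S_def)
        finally show ?thesis by (simp add: y_def)
      qed
    qed
    have "c0 / 2 * s * ((1 - \<epsilon>) * \<mu> N - Re (G N (t *\<^sub>R b))) \<le> (\<integral>u. A u \<partial>M N)" for N
    proof -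
      interpret finite_measure "M N" by (rule M)
      have i: "integrable (M N) (\<lambda>u. cis (u \<bullet> (t *\<^sub>R b)))"
        by (intro integrable_bounded_continuous[OF M, where c = 1] continuous_intros) auto
      have i': "integrable (M N) (\<lambda>u. cos (t * (u \<bullet> b)))" using integrable_Re[OF i] by simp
      have "Re (G N (t *\<^sub>R b)) = (\<integral>u. Re (cis (u \<bullet> (t *\<^sub>R b))) \<partial>M N)"
        unfolding G_def by (rule integral_Re[OF i, symmetric])
      then have "c0 / 2 * s * ((1 - \<epsilon>) * \<mu> N - Re (G N (t *\<^sub>R b)))
          = (\<integral>u. c0 / 2 * s * (1 - \<epsilon> - cos (t * (u \<bullet> b))) \<partial>M N)"
        using i' by (simp add: \<mu>_def space_M)
      also have "\<dots> \<le> (\<integral>u. A u \<partial>M N)"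
        using A_ge i' pair(2) by (intro integral_mono) auto
      finally show ?thesis .
    qed
    moreover have "(\<lambda>N. c0 / 2 * s * ((1 - \<epsilon>) * \<mu> N - Re (G N (t *\<^sub>R b))))
        \<longlonglongrightarrow> c0 / 2 * s * ((1 - \<epsilon>) * Re (g 0) - Re (g (t *\<^sub>R b)))"
      by (intro tendsto_intros lim_\<mu> lim_G)
    ultimately have "c0 / 2 * s * ((1 - \<epsilon>) * Re (g 0) - Re (g (t *\<^sub>R b))) \<le> 4 * pi * Re Q"
      using lim_A by (intro LIMSEQ_le) auto
    also have "(1 - \<epsilon>) * Re (g 0) - Re (g (t *\<^sub>R b)) = (f0 - ft) / 2"
      unfolding g_def norm_tb using f0
        by (simp add: \<epsilon>_def f0_def[symmetric] ft_def[symmetric] field_simps)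
    finally have "\<kappa> * s \<le> Re Q" by (simp add: \<kappa>_def field_simps)
    moreover have "0 \<le> Q" using pd unfolding Q_def positive_definite_def by simp
    then have "Im Q = 0" by (simp add: less_eq_complex_def)
    ultimately have "complex_of_real (\<kappa> * s) \<le> Q" by (simp add: less_eq_complex_def)
    then show ?thesis by (simp only: Q_def g_def s_def)
  qed
  ultimately show ?thesis unfolding strongly_positive_definite_def by blast
qed

theorem proposition2p18:
  fixes f :: "real \<Rightarrow> complex"
    and x :: "nat \<Rightarrow> real ^ 'n::{finite, linorder}"
  assumes "CARD('n) \<ge> 2"
    and "f \<in> Phi TYPE(real ^ 'n::{finite, linorder})"
    and "\<not> f constant_on {0..}"
    and "\<And>k. x k $ Min UNIV = 0"
    and "separation (\<lambda>k. x k $ Max UNIV) > 0"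
    and "upper_density (\<lambda>k. x k $ Max UNIV) = 0"
  shows "strongly_positive_definite x f"
proof -
  have "Min (UNIV :: 'n set) \<noteq> Max UNIV"
  proof
    assume eq: "Min (UNIV :: 'n set) = Max UNIV"
    have "i = Max UNIV" for i :: 'n
    proof (rule antisym)
      show "i \<le> Max UNIV" by simp
      show "Max UNIV \<le> i" unfolding eq[symmetric] by simp
    qed
    then have "(UNIV :: 'n set) = {Max UNIV}" by blast
    then have "CARD('n) = 1" by (metis card_1_singleton_iff One_nat_def)
    with assms(1) show False by simp
  qed
  then have "axis (Min UNIV) (1 :: real) $ (Max UNIV :: 'n) = 0"
    by (simp add: axis_def)
  then show ?thesis
    using assms
    by (intro strongly_positive_definite_of_orthogonal[of f "axis (Min UNIV) 1" "axis (Max UNIV) 1"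
        x])
      (auto simp: inner_axis inner_axis_axis)
qed

end
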